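(* Let $u\in(0,1]$ and let $A$ and $B$ be independent random variables, each distributed according to the same probability distribution on subsets of $[n]$. Assume that $\Pr[i\in A]\le u$ for all $i\in[n]$. Then \[ H(A\cup B)\ \ge\ H(A)\cdot \begin{cases} \dfrac{H(2u-u^2)}{H(u)} & \text{if } u\le \frac{3-\sqrt5}{2},\\[2mm] (1-u)\dfrac{2}{\sqrt5-1} & \text{if } u\ge \frac{3-\sqrt5}{2}.\end{cases}\]
   Context: For a random variable $X$ taking values in subsets of $[n]$, $H(X)$ denotes its Shannon entropy $-\sum_S \Pr[X=S]\log\Pr[X=S]$. For $p\in[0,1]$, $H(p)=-p\log p-(1-p)\log(1-p)$ (with $0\log 0=0$) is the binary entropy function. *)

theory Defs
  imports "HOL-Probability.Probability"
begin

definition binary_entropy :: "real \<Rightarrow> real \<Rightarrow> real" where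
  "binary_entropy b p = - p * log b p - (1 - p) * log b (1 - p)"

lemma binary_entropy_0 [simp]: "binary_entropy b 0 = 0"
  and binary_entropy_1 [simp]: "binary_entropy b 1 = 0"
  by (simp_all add: binary_entropy_def)

text \<open>
  Relative to the counting measure on a finite set, the library's entropy (a negated
  Kullback-Leibler divergence) is the Shannon sum; values of probability 0 contribute 0.
\<close>

lemma (in information_space) entropy_count_space_finite:
  assumes "finite S" and X: "X \<in> measurable M (count_space S)"
  shows "entropy b (count_space S) X =
    - (\<Sum>s\<in>S. prob {\<omega> \<in> space M. X \<omega> = s} * log b (prob {\<omega> \<in> space M. X \<omega> = s}))"
proof -
  let ?f = "\<lambda>s. prob {\<omega> \<in> space M. X \<omega> = s}"
  have emeasure_eq: "emeasure M (X -` {s} \<inter> space M) = ennreal (?f s)" for s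
    by (simp add: emeasure_eq_measure Int_def vimage_def conj_commute)
  have "distr M (count_space S) X = density (count_space S) ?f"
  proof (rule measure_eqI_finite)
    fix s assume s: "s \<in> S"
    have "emeasure (distr M (count_space S) X) {s} = ennreal (?f s)"
      using s X by (simp add: emeasure_distr emeasure_eq)
    also have "\<dots> = emeasure (density (count_space S) ?f) {s}"
      using s \<open>finite S\<close>
      by (simp add: emeasure_density nn_integral_count_space_finite indicator_def if_distrib
          cong: if_cong)
    finally show "emeasure (distr M (count_space S) X) {s} =
        emeasure (density (count_space S) ?f) {s}" .
  qed (use \<open>finite S\<close> in simp_all)
  then have "distributed M (count_space S) X ?f"
    using X by (simp add: distributed_def)
  then show ?thesis
    using \<open>finite S\<close> by (simp add: entropy_distr lebesgue_integral_count_space_finite)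
qed

end

theory Submission
  imports Defs "HOL-Real_Asymp.Real_Asymp"
begin

text \<open>
  Write \<open>G\<close> for the binary entropy and let \<open>x\<close> be the conditional probability that the next element
  is missing from the random set, given the set so far. By the chain rule the theorem reduces to
  \<open>E G(x y) \<ge> K m E G(x)\<close> for independent copies \<open>x\<close>, \<open>y\<close> of a \<open>[0,1]\<close>-valued variable of mean \<open>m\<close>,
  whenever \<open>G(t\<^sup>2) \<ge> K t G(t)\<close> for all \<open>t\<close> in \<open>[m,1]\<close>.

  Modulo terms that vanish when \<open>\<Sum> c\<^sub>i x\<^sub>i = 0\<close>, the kernel \<open>- G(x y)\<close> is the power series
  \<open>\<Sum>\<^sub>k (x y)\<^sup>k / (k (k - 1))\<close> with nonnegative coefficients, so \<open>E G(x y)\<close> is concave on the laws of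
  mean \<open>m\<close> and is minimised, relative to \<open>E G(x)\<close>, by a law on two points. The first variation at
  such a minimiser is first concave and then convex in \<open>x\<close>, which forces one of the points to be
  \<open>0\<close> (or the law to be a point mass); there the inequality is the hypothesis on \<open>K\<close>.

  The remaining one-variable facts on \<open>G(t\<^sup>2) / (t G(t))\<close>, namely that its minimum is at the golden
  ratio conjugate and that it increases afterwards, follow by counting sign changes: \<open>t\<^sup>3\<close> times the
  second derivative of \<open>G(t\<^sup>2) / t - k G(t)\<close> vanishes at \<open>0\<close> and its derivative has the sign of a
  concave cubic, so the second derivative is positive on an interval only.
\<close>

section \<open>The binary entropy of a square\<close>

definition eta :: "real \<Rightarrow> real" where
  "eta x = - x * ln x"

definition bent :: "real \<Rightarrow> real" where
  "bent x = eta x + eta (1 - x)"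

lemma eta_0 [simp]: "eta 0 = 0" and eta_1 [simp]: "eta 1 = 0"
  by (simp_all add: eta_def)

lemma bent_0 [simp]: "bent 0 = 0" and bent_1 [simp]: "bent 1 = 0"
  by (simp_all add: bent_def)

lemma eta_nonneg: "0 \<le> x \<Longrightarrow> x \<le> 1 \<Longrightarrow> 0 \<le> eta x"
  by (cases "x = 0") (auto simp: eta_def mult_nonneg_nonpos)

lemma bent_nonneg: "0 \<le> x \<Longrightarrow> x \<le> 1 \<Longrightarrow> 0 \<le> bent x"
  by (simp add: bent_def eta_nonneg)

lemma bent_pos: 
  assumes "0 < x" "x < 1" shows "0 < bent x"
proof -
  have "0 < eta x"
    using assms by (simp add: eta_def mult_pos_neg)
  then show ?thesis
    using assms eta_nonneg[of "1 - x"] by (simp add: bent_def)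
qed

lemma continuous_on_eta: "continuous_on {0..} eta"
proof -
  have "((\<lambda>x::real. - x * ln x) \<longlongrightarrow> 0) (at_right 0)"
    by real_asymp
  then have "(eta \<longlongrightarrow> eta 0) (at 0 within {0..})"
    by (simp add: eta_def[abs_def] at_within_Ici_at_right)
  moreover have "(eta \<longlongrightarrow> eta x) (at x within {0..})" if "x > 0" for x
    unfolding eta_def using that by (intro tendsto_intros) auto
  ultimately show ?thesis
    unfolding continuous_on_def by (metis atLeast_iff order_le_less)
qed

text \<open>The positive root of t^2 + t = 1, so squaring it gives \<open>1 - golden\<close>, a
  point of equal entropy.\<close>

definition golden :: real where
  "golden = (sqrt 5 - 1) / 2"

lemma golden_sq: "golden\<^sup>2 = 1 - golden"
  by (simp add: golden_def field_simps power2_eq_square)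

lemma golden_gt: "0.618 < golden" and golden_less: "golden < 0.6181"
proof -
  have "2.236 < sqrt (5::real)" by (rule real_less_rsqrt) (simp add: power2_eq_square)
  moreover have "sqrt (5::real) < 2.2362" by (rule real_less_lsqrt) (simp_all add: power2_eq_square)
  ultimately show "0.618 < golden" "golden < 0.6181" by (simp_all add: golden_def)
qed

section \<open>The function \<open>gap\<close>, its derivatives and their sign changes\<close>

definition gap :: "real \<Rightarrow> real \<Rightarrow> real" where
  "gap k x = - 2 * x * ln x - (1 / x - x) * ln (1 - x\<^sup>2) + k * (x * ln x + (1 - x) * ln (1 - x))"

definition gap' :: "real \<Rightarrow> real \<Rightarrow> real" where
  "gap' k x = (1 + 1 / x\<^sup>2) * ln (1 - x\<^sup>2) - 2 * ln x + k * (ln x - ln (1 - x))"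

text \<open>\<open>x ^ 3\<close> times the second derivative of \<open>gap k\<close>: the logarithm
  now has a constant coefficient and disappears after one more differentiation.\<close>

definition gapP :: "real \<Rightarrow> real \<Rightarrow> real" where
  "gapP k x = - 2 * ln (1 - x\<^sup>2) - 4 * x\<^sup>2 / (1 - x\<^sup>2) + k * x\<^sup>2 / (1 - x)"

text \<open>For \<open>0 < x < 1\<close> the sign of \<open>gap k x\<close> decides whether
  \<open>bent (x\<^sup>2) / (x * bent x)\<close> lies above or below \<open>k\<close>.\<close>

lemma gap_bent: "0 < x \<Longrightarrow> gap k x = bent (x\<^sup>2) / x - k * bent x"
  by (simp add: gap_def bent_def eta_def ln_realpow field_simps) (simp add: power2_eq_square)

lemma sq_less_1: "0 < x \<Longrightarrow> x < 1 \<Longrightarrow> x\<^sup>2 < (1::real)"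
  by (simp add: power_less_one_iff)

lemma gap_deriv:
  assumes "0 < x" "x < 1"
  shows "(gap k has_real_derivative gap' k x) (at x)"
proof -
  have *: "1 - x\<^sup>2 > 0" using sq_less_1[OF assms] by simp
  show ?thesis
    unfolding gap_def
    apply (rule derivative_eq_intros refl | (use assms * in simp; fail))+
    using assms sq_less_1[OF assms]
    apply (simp add: gap'_def divide_simps)
    by (simp add: algebra_simps power2_eq_square)
qed

lemma gap'_deriv:
  assumes "0 < x" "x < 1"
  shows "(gap' k has_real_derivative gapP k x / x ^ 3) (at x)"
proof -
  have *: "1 - x\<^sup>2 > 0" using sq_less_1[OF assms] by simp
  show ?thesis
    unfolding gap'_def
    apply (rule derivative_eq_intros refl | (use assms * in simp; fail))+
    using assms sq_less_1[OF assms]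
    apply (simp add: gapP_def divide_simps)
    by (simp add: algebra_simps power2_eq_square power3_eq_cube power_def)
qed

definition cub :: "real \<Rightarrow> real \<Rightarrow> real" where
  "cub k x = - k * x ^ 3 - 4 * x\<^sup>2 + 3 * k * x + 2 * k - 4"

lemma gapP_deriv:
  assumes "0 \<le> x" "x < 1"
  shows "(gapP k has_real_derivative cub k x * (x / (1 - x\<^sup>2)\<^sup>2)) (at x)"
proof -
  have *: "1 - x\<^sup>2 > 0" using assms by (simp add: power_less_one_iff)
  have e: "1 - x\<^sup>2 = (1 - x) * (1 + x)" by (simp add: algebra_simps power2_eq_square)
  show ?thesis
    unfolding gapP_def
    apply (rule derivative_eq_intros refl | (use assms * in simp; fail))+
    using assms *
    unfolding cub_def e
    apply (simp add: divide_simps)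
    by (simp add: algebra_simps power2_eq_square power3_eq_cube power_def)
qed

lemma cub_concave:
  assumes "0 \<le> k" "0 < x" "x < y" "y < z" "cub k x > 0" "cub k z > 0"
  shows "cub k y > 0"
proof -
  \<comment> \<open>Chord interpolation with exact error: the second divided difference of
    \<open>cub k\<close> is \<open>- (k * (x + y + z) + 4)\<close>.\<close>
  have "(z - x) * cub k y = (z - y) * cub k x + (y - x) * cub k z + (z - x) * (y - x) * (z - y) * (k * (x + y + z) + 4)"
    by (simp add: cub_def algebra_simps power2_eq_square power3_eq_cube)
  also have "\<dots> > 0"
    using assms by (intro add_pos_nonneg add_pos_pos mult_pos_pos mult_nonneg_nonneg) auto
  finally show ?thesis using assms by (simp add: zero_less_mult_iff)
qed

text \<open>As \<open>gapP k 0 = 0\<close>, a dip between two positive values would force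
  \<open>cub k\<close> to be positive, negative and positive in turn, against
  \<open>cub_concave\<close>.\<close>

lemma gapP_pos_interval:
  assumes "0 \<le> k" "0 < x" "x < y" "y < z" "z < 1" "gapP k x > 0" "gapP k z > 0"
  shows "gapP k y > 0"
proof (rule ccontr)
  assume "\<not> gapP k y > 0"
  have pos: "t / (1 - t\<^sup>2)\<^sup>2 > 0" if "0 < t" "t < 1" for t :: real
    using that sq_less_1[of t] by simp
  have mvt: "\<exists>t. s < t \<and> t < r \<and> gapP k r - gapP k s = (r - s) * (cub k t * (t / (1 - t\<^sup>2)\<^sup>2))"
    if "0 \<le> s" "s < r" "r < 1" for s r
    using that by (intro MVT2 gapP_deriv) auto
  obtain t1 where t1: "0 < t1" "t1 < x" "gapP k x - gapP k 0 = (x - 0) * (cub k t1 * (t1 / (1 - t1\<^sup>2)\<^sup>2))"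
    using mvt[of 0 x] assms by auto
  obtain t2 where t2: "x < t2" "t2 < y" "gapP k y - gapP k x = (y - x) * (cub k t2 * (t2 / (1 - t2\<^sup>2)\<^sup>2))"
    using mvt[of x y] assms by auto
  obtain t3 where t3: "y < t3" "t3 < z" "gapP k z - gapP k y = (z - y) * (cub k t3 * (t3 / (1 - t3\<^sup>2)\<^sup>2))"
    using mvt[of y z] assms by auto
  have "gapP k 0 = 0" by (simp add: gapP_def)
  have "cub k t1 > 0"
  proof -
    have "x * (cub k t1 * (t1 / (1 - t1\<^sup>2)\<^sup>2)) > 0"
      using t1 assms \<open>gapP k 0 = 0\<close> by simp
    then show ?thesis
      using t1 assms pos[of t1] by (metis zero_less_mult_pos zero_less_mult_pos2 less_trans)
  qed
  moreover have "(z - y) * (cub k t3 * (t3 / (1 - t3\<^sup>2)\<^sup>2)) > 0"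
    using t3 assms \<open>\<not> gapP k y > 0\<close> by linarith
  then have "cub k t3 > 0"
  proof -
    have "cub k t3 * (t3 / (1 - t3\<^sup>2)\<^sup>2) > 0"
      using \<open>(z - y) * _ > 0\<close> assms by (simp only: zero_less_mult_iff) linarith
    then show ?thesis
      using t3 assms pos[of t3] by (metis zero_less_mult_pos2 less_trans)
  qed
  ultimately have "cub k t2 > 0"
    using cub_concave[of k t1 t2 t3] t1 t2 t3 assms by auto
  then have "(y - x) * (cub k t2 * (t2 / (1 - t2\<^sup>2)\<^sup>2)) > 0"
    using t2 assms pos[of t2] by (intro mult_pos_pos) auto
  then show False using t2(3) assms \<open>\<not> gapP k y > 0\<close> by linarith
qed

text \<open>Up, down, up would give the second derivative of \<open>gap k\<close> the signs +, -, +,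
  which \<open>gapP_pos_interval\<close> excludes. Later sign counts all end here.\<close>

lemma gap'_no_zigzag:
  assumes "0 \<le> k" "0 < a" "a < b" "b < c" "c < d" "d < 1"
    and "gap' k a < gap' k b" "gap' k c < gap' k b" "gap' k c < gap' k d"
  shows False
proof -
  have mvt: "\<exists>t. s < t \<and> t < r \<and> gap' k r - gap' k s = (r - s) * (gapP k t / t ^ 3)"
    if "0 < s" "s < r" "r < 1" for s r
    using that by (intro MVT2 gap'_deriv) auto
  obtain t1 where t1: "a < t1" "t1 < b" "gap' k b - gap' k a = (b - a) * (gapP k t1 / t1 ^ 3)"
    using mvt[of a b] assms by auto
  obtain t2 where t2: "b < t2" "t2 < c" "gap' k c - gap' k b = (c - b) * (gapP k t2 / t2 ^ 3)"
    using mvt[of b c] assms by auto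
  obtain t3 where t3: "c < t3" "t3 < d" "gap' k d - gap' k c = (d - c) * (gapP k t3 / t3 ^ 3)"
    using mvt[of c d] assms by auto
  have "(b - a) * (gapP k t1 / t1 ^ 3) > 0" "(d - c) * (gapP k t3 / t3 ^ 3) > 0"
    using t1 t3 assms by linarith+
  then have "gapP k t1 > 0" "gapP k t3 > 0"
    using t1 t3 assms by (auto simp: zero_less_mult_iff zero_less_divide_iff)
  then have "gapP k t2 > 0"
    using gapP_pos_interval[of k t1 t2 t3] t1 t2 t3 assms by auto
  then have "(c - b) * (gapP k t2 / t2 ^ 3) > 0"
    using t2 assms by auto
  then show False using t2(3) assms by linarith
qed

lemma gap_mvt:
  assumes "0 < s" "s < r" "r < 1"
  shows "\<exists>t. s < t \<and> t < r \<and> gap k r - gap k s = (r - s) * gap' k t"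
  using assms by (intro MVT2 gap_deriv) auto

lemma gap_increase:
  assumes "0 < s" "s < r" "r < 1" "gap k s < gap k r"
  obtains t where "s < t" "t < r" "gap' k t > 0"
proof -
  obtain t where t: "s < t" "t < r" "gap k r - gap k s = (r - s) * gap' k t"
    using gap_mvt[OF assms(1-3), of k] by auto
  then have "(r - s) * gap' k t > 0" using assms by linarith
  then have "gap' k t > 0" using assms by (auto simp: zero_less_mult_iff)
  with t that show ?thesis by blast
qed

lemma gap_decrease:
  assumes "0 < s" "s < r" "r < 1" "gap k s > gap k r"
  obtains t where "s < t" "t < r" "gap' k t < 0"
proof -
  obtain t where t: "s < t" "t < r" "gap k r - gap k s = (r - s) * gap' k t"
    using gap_mvt[OF assms(1-3), of k] by auto
  then have "(r - s) * gap' k t < 0" using assms by linarith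
  then have "gap' k t < 0" using assms by (auto simp: mult_less_0_iff)
  with t that show ?thesis by blast
qed

text \<open>\<open>gap k\<close> tends to 0 at 0, so the end point acts as a further known value in
  sign counts; the next lemma does the same at 1.\<close>

lemma gap_at_0:
  assumes "gap k x < 0" "0 < x"
  obtains a where "0 < a" "a < x" "gap k x < gap k a"
proof -
  have "((\<lambda>x::real. - 2 * x * ln x - (1 / x - x) * ln (1 - x\<^sup>2)) \<longlongrightarrow> 0) (at_right 0)"
    by real_asymp
  moreover have "((\<lambda>x::real. x * ln x + (1 - x) * ln (1 - x)) \<longlongrightarrow> 0) (at_right 0)"
    by real_asymp
  ultimately have "(gap k \<longlongrightarrow> 0 + k * 0) (at_right 0)"
    unfolding gap_def[abs_def] by (intro tendsto_add tendsto_mult_left)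
  then have "eventually (\<lambda>a. gap k x < gap k a) (at_right 0)"
    using assms by (intro order_tendstoD(1)) auto
  moreover have "eventually (\<lambda>a. a \<in> {0<..<x}) (at_right 0)"
    using assms by (intro eventually_at_right_real) auto
  ultimately have "eventually (\<lambda>a. gap k x < gap k a \<and> a \<in> {0<..<x}) (at_right 0)"
    by (rule eventually_conj)
  then show ?thesis
    using that by (auto dest!: eventually_happens'[rotated])
qed

lemma gap_at_1:
  assumes "gap k x < 0" "x < 1"
  obtains a where "x < a" "a < 1" "gap k x < gap k a"
proof -
  have "((\<lambda>x::real. - 2 * x * ln x - (1 / x - x) * ln (1 - x\<^sup>2)) \<longlongrightarrow> 0) (at_left 1)"
    by real_asymp
  moreover have "((\<lambda>x::real. x * ln x + (1 - x) * ln (1 - x)) \<longlongrightarrow> 0) (at_left 1)"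
    by real_asymp
  ultimately have "(gap k \<longlongrightarrow> 0 + k * 0) (at_left 1)"
    unfolding gap_def[abs_def] by (intro tendsto_add tendsto_mult_left)
  then have "eventually (\<lambda>a. gap k x < gap k a) (at_left 1)"
    using assms by (intro order_tendstoD(1)) auto
  moreover have "eventually (\<lambda>a. a \<in> {x<..<1}) (at_left 1)"
    using assms by (intro eventually_at_left_real) auto
  ultimately have "eventually (\<lambda>a. gap k x < gap k a \<and> a \<in> {x<..<1}) (at_left 1)"
    by (rule eventually_conj)
  then show ?thesis
    using that by (auto dest!: eventually_happens'[rotated])
qed

lemma golden_bounds: "0 < golden" "golden < 1"
  using golden_gt golden_less by auto

section \<open>The minimum at the golden ratio conjugate\<close>

lemma gap'_golden: "gap' (1 + golden) golden = 0"
proof -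
  \<comment> \<open>All logarithms become multiples of \<open>ln golden\<close>, and the
    coefficients cancel.\<close>
  have e: "1 - golden\<^sup>2 = golden" "1 - golden = golden\<^sup>2" "1 / golden\<^sup>2 = 2 + golden"
    using golden_sq golden_bounds by (auto simp: divide_simps) (simp_all add: power2_eq_square algebra_simps)
  show ?thesis
    unfolding gap'_def e using golden_bounds by (simp add: ln_realpow algebra_simps)
qed

lemma gap_golden: "gap k golden = (1 + golden - k) * bent golden"
proof -
  have "1 / golden = 1 + golden"
    using golden_sq golden_bounds by (simp add: divide_simps) (simp add: power2_eq_square algebra_simps)
  moreover have "bent (golden\<^sup>2) = bent golden"
    by (simp add: bent_def golden_sq)
  ultimately show ?thesis
    using golden_bounds by (simp add: gap_bent left_diff_distrib divide_inverse) 
qed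

text \<open>Positive curvature makes the critical point \<open>golden\<close> a strict local minimum
  of \<open>gap (1 + golden)\<close>.\<close>

lemma gapP_golden: "gapP (1 + golden) golden > 0"
proof -
  have e: "1 - golden\<^sup>2 = golden" "1 - golden = golden\<^sup>2" "4 * golden\<^sup>2 / golden = 4 * golden"
    using golden_sq golden_bounds by (auto simp: field_simps power2_eq_square)
  have "gapP (1 + golden) golden = 1 - 3 * golden - 2 * ln golden"
    unfolding gapP_def e using golden_bounds by simp
  moreover have "ln golden = 4 * ln (sqrt (sqrt golden))"
    \<comment> \<open>The bound \<open>ln t \<le> t - 1\<close> at \<open>golden\<close> itself is
      too weak; it is applied to the fourth root, which is at most 0.89.\<close>
    using golden_bounds by (simp add: ln_sqrt)
  moreover have "ln (sqrt (sqrt golden)) \<le> sqrt (sqrt golden) - 1"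
    using golden_bounds by (intro ln_le_minus_one) auto
  moreover have "sqrt (sqrt golden) \<le> 0.89"
    using golden_less golden_bounds by (intro real_le_lsqrt) (auto simp: power2_eq_square)
  ultimately show ?thesis using golden_less by simp
qed

text \<open>A negative value, between the strict local minimum of value 0 at \<open>golden\<close>
  and the limit 0 at the end point on its side, would make the derivative zigzag.\<close>

lemma gap_golden_nonneg:
  assumes "0 < x" "x < 1"
  shows "gap (1 + golden) x \<ge> 0"
proof (rule ccontr)
  let ?k = "1 + golden"
  assume "\<not> gap ?k x \<ge> 0"
  then have neg: "gap ?k x < 0" by simp
  have 0: "gap ?k golden = 0" by (simp add: gap_golden)
  have k: "0 \<le> ?k" using golden_bounds by simp
  have D: "gapP ?k golden / golden ^ 3 > 0"
    using gapP_golden golden_bounds by simp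
  have "x \<noteq> golden" using neg 0 by auto
  then consider "golden < x" | "x < golden" by linarith
  then show False
  proof cases
    case 1
    obtain d where d: "d > 0" "\<And>h. h > 0 \<Longrightarrow> h < d \<Longrightarrow> gap' ?k golden < gap' ?k (golden + h)"
      using DERIV_pos_inc_right[OF gap'_deriv[OF golden_bounds] D] by auto
    \<comment> \<open>\<open>w\<close> lies between \<open>golden\<close> and \<open>x\<close>, so
      close to \<open>golden\<close> that \<open>gap'\<close> is positive up to
      \<open>w\<close>.\<close>
    define h where "h = min (d / 2) ((x - golden) / 2)"
    have h: "0 < h" "h < d" "golden + h < x"
      using d 1 by (auto simp: h_def min_def field_simps)
    define w where "w = golden + h"
    have pos: "gap' ?k t > 0" if "golden < t" "t \<le> w" for t
      using d(2)[of "t - golden"] that h by (simp add: w_def gap'_golden)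
    have "gap ?k w > 0"
      using gap_mvt[of golden w ?k] pos h assms golden_bounds 0 
      by (auto simp: w_def)
    then obtain t where t: "w < t" "t < x" "gap' ?k t < 0"
      using gap_decrease[of w x ?k] neg h assms golden_bounds by (auto simp: w_def)
    obtain a where a: "x < a" "a < 1" "gap ?k x < gap ?k a"
      using gap_at_1[OF neg] assms by blast
    then obtain s where s: "x < s" "s < a" "gap' ?k s > 0"
      using gap_increase[of x a ?k] assms by auto
    \<comment> \<open>\<open>gap'\<close> is 0 at \<open>golden\<close>, positive at
      \<open>w\<close>, negative at \<open>t\<close>, positive at \<open>s\<close>.\<close>
    show False
      using gap'_no_zigzag[of ?k golden w t s] pos[of w] h t s a k golden_bounds gap'_golden
      by (auto simp: w_def)
  next
    case 2
    obtain d where d: "d > 0" "\<And>h. h > 0 \<Longrightarrow> h < d \<Longrightarrow> gap' ?k (golden - h) < gap' ?k golden"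
      using DERIV_pos_inc_left[OF gap'_deriv[OF golden_bounds] D] by auto
    define h where "h = min (d / 2) ((golden - x) / 2)"
    have h: "0 < h" "h < d" "x < golden - h"
      using d 2 by (auto simp: h_def min_def field_simps)
    define w where "w = golden - h"
    have ng: "gap' ?k t < 0" if "w \<le> t" "t < golden" for t
      using d(2)[of "golden - t"] that h by (simp add: w_def gap'_golden)
    have "gap ?k w > 0"
    proof -
      obtain t where t: "w < t" "t < golden" "gap ?k golden - gap ?k w = (golden - w) * gap' ?k t"
        using gap_mvt[of w golden ?k] h assms golden_bounds by (auto simp: w_def)
      have "(golden - w) * gap' ?k t < 0"
        using ng[of t] t by (intro mult_pos_neg) auto
      then show ?thesis using t 0 by simp
    qed
    then obtain t where t: "x < t" "t < w" "gap' ?k t > 0"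
      using gap_increase[of x w ?k] neg h assms golden_bounds by (auto simp: w_def)
    obtain a where a: "0 < a" "a < x" "gap ?k x < gap ?k a"
      using gap_at_0[OF neg] assms by blast
    then obtain s where s: "a < s" "s < x" "gap' ?k s < 0"
      using gap_decrease[of a x ?k] assms by auto
    show False
      using gap'_no_zigzag[of ?k s t w golden] ng[of w] h t s a k golden_bounds gap'_golden
      by (auto simp: w_def)
  qed
qed

lemma bent_sq_ge:
  assumes "0 \<le> x" "x \<le> 1"
  shows "bent (x\<^sup>2) \<ge> (1 + golden) * x * bent x"
proof (cases "x = 0 \<or> x = 1")
  case False
  then show ?thesis
    using gap_golden_nonneg[of x] assms by (simp add: gap_bent field_simps)
qed auto

text \<open>If the ratio \<open>bent (y\<^sup>2) / (y * bent y)\<close> fell between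
  \<open>w\<close> and \<open>x\<close>, then for a level \<open>k\<close> in between
  \<open>gap k\<close> would be 0, -, +, -, 0 at 0, \<open>golden\<close>, \<open>w\<close>,
  \<open>x\<close>, 1, and its derivative would zigzag.\<close>

lemma bent_sq_ratio_mono:
  assumes "golden \<le> w" "w < 1" "w \<le> x" "x \<le> 1"
  shows "bent (x\<^sup>2) \<ge> bent (w\<^sup>2) / (w * bent w) * x * bent x"
proof (cases "x = 1 \<or> w = x")
  case True
  then show ?thesis using assms golden_bounds bent_pos[of w] by auto
next
  case False
  show ?thesis
  proof (rule ccontr)
    have x: "w < x" "x < 1" "0 < w" using False assms golden_bounds by auto
    define h where "h y = bent (y\<^sup>2) / (y * bent y)" for y
    have less: "gap k y < 0 \<longleftrightarrow> h y < k" "gap k y > 0 \<longleftrightarrow> h y > k" if "0 < y" "y < 1" for k y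
      using that bent_pos[of y] by (auto simp: gap_bent h_def field_simps)
    have ge: "h y \<ge> 1 + golden" if "0 < y" "y < 1" for y
      using less(1)[of y "1 + golden"] gap_golden_nonneg[of y] that by auto
    assume "\<not> ?thesis"
    then have "h x < h w"
      using bent_pos[of x] x by (simp add: h_def field_simps)
    then obtain k where k: "h x < k" "k < h w" using dense by blast
    have kg: "k > 1 + golden" using ge[of x] k x by auto
    then have k0: "0 \<le> k" using golden_bounds by simp
    have g: "gap k golden < 0" 
      using kg bent_pos[OF golden_bounds] by (simp add: gap_golden mult_neg_pos)
    have w: "gap k w > 0" using less k x by auto
    have xn: "gap k x < 0" using less k x by auto
    have gw: "golden < w" using g w assms by (cases "golden = w") auto
    obtain a where a: "0 < a" "a < golden" "gap k golden < gap k a"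
      using gap_at_0[OF g] golden_bounds by blast
    then obtain t1 where t1: "a < t1" "t1 < golden" "gap' k t1 < 0"
      using gap_decrease[of a golden k] golden_bounds by auto
    obtain t2 where t2: "golden < t2" "t2 < w" "gap' k t2 > 0"
      using gap_increase[of golden w k] golden_bounds gw x g w by auto
    obtain t3 where t3: "w < t3" "t3 < x" "gap' k t3 < 0"
      using gap_decrease[of w x k] x w xn by auto
    obtain c where c: "x < c" "c < 1" "gap k x < gap k c"
      using gap_at_1[OF xn] x by blast
    then obtain t4 where t4: "x < t4" "t4 < c" "gap' k t4 > 0"
      using gap_increase[of x c k] x by auto
    show False
      using gap'_no_zigzag[of k t1 t2 t3 t4] k0 t1 t2 t3 t4 a c by auto
  qed
qed

section \<open>Concavity of the entropy kernel\<close>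

text \<open>That is \<open>z + (1 - z) * ln (1 - z)\<close> for \<open>z < 1\<close>, extended
  continuously by 1 at \<open>z = 1\<close>.\<close>

definition lnT :: "real \<Rightarrow> real" where
  "lnT z = z - eta (1 - z)"

lemma lnT_sums:
  assumes "0 \<le> z" "z < 1"
  shows "(\<lambda>k. (1 / real (k + 1) - 1 / real (k + 2)) * z ^ (k + 2)) sums lnT z"
proof -
  have 0: "(\<lambda>n. z ^ n / real n) sums - ln (1 - z)"
    using sums_minus[OF ln_series'[of "- z"]] assms by (simp add: power_minus')
  \<comment> \<open>The term at \<open>n = 0\<close> is \<open>1 / 0 = 0\<close>, so dropping it
    does not change the sum.\<close>
  have 1: "(\<lambda>n. z ^ (n + 1) / real (n + 1)) sums - ln (1 - z)"
    using 0 sums_iff_shift[of "\<lambda>n. z ^ n / real n" 1 "- ln (1 - z)"] by simp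
  have 2: "(\<lambda>n. z ^ (n + 2) / real (n + 2)) sums (- ln (1 - z) - z)"
    using 1 sums_iff_shift[of "\<lambda>n. z ^ (n + 1) / real (n + 1)" 1 "- ln (1 - z) - z"] by (simp add: add.commute)
  have "(\<lambda>n. z * (z ^ (n + 1) / real (n + 1)) - z ^ (n + 2) / real (n + 2)) sums
      (z * (- ln (1 - z)) - (- ln (1 - z) - z))"
    by (intro sums_diff sums_mult 1 2)
  then show ?thesis
    by (simp add: lnT_def eta_def algebra_simps)
qed

lemma continuous_on_lnT: "continuous_on {..1} lnT"
  unfolding lnT_def
  by (intro continuous_intros continuous_on_compose2[OF continuous_on_eta]) auto

text \<open>Each power \<open>(x i * x j) ^ k\<close> contributes a square to the quadratic form,
  and the coefficients of the series are nonnegative.\<close>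

lemma lnT_kernel_nonneg:
  fixes c x :: "'i \<Rightarrow> real"
  assumes "finite I" "\<And>i. i \<in> I \<Longrightarrow> 0 \<le> x i \<and> x i \<le> 1"
  shows "0 \<le> (\<Sum>i\<in>I. \<Sum>j\<in>I. c i * c j * lnT (x i * x j))"
proof -
  \<comment> \<open>The series is available only below 1, so the arguments are shrunk by
    \<open>r < 1\<close> and \<open>r\<close> then tends to 1.\<close>
  let ?Q = "\<lambda>r. \<Sum>i\<in>I. \<Sum>j\<in>I. c i * c j * lnT (r * (x i * x j))"
  have xx: "0 \<le> x i * x j \<and> x i * x j \<le> 1" if "i \<in> I" "j \<in> I" for i j
    using assms(2)[of i] assms(2)[of j] that by (auto intro: mult_le_one)
  have pos: "0 \<le> ?Q r" if r: "0 < r" "r < 1" for r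
  proof -
    let ?a = "\<lambda>k. 1 / real (k + 1) - 1 / real (k + 2)"
    have z: "0 \<le> r * (x i * x j) \<and> r * (x i * x j) < 1" if "i \<in> I" "j \<in> I" for i j
    proof -
      have "r * (x i * x j) \<le> r * 1"
        using xx[OF that] r by (intro mult_left_mono) auto
      then show ?thesis using xx[OF that] r by (metis less_eq_real_def le_less_trans mult.right_neutral mult_nonneg_nonneg)
    qed
    have "(\<lambda>k. \<Sum>i\<in>I. \<Sum>j\<in>I. c i * c j * (?a k * (r * (x i * x j)) ^ (k + 2))) sums ?Q r"
      by (intro sums_sum sums_mult lnT_sums) (use z in auto)
    moreover have "(\<Sum>i\<in>I. \<Sum>j\<in>I. c i * c j * (?a k * (r * (x i * x j)) ^ (k + 2))) =
        ?a k * r ^ (k + 2) * (\<Sum>i\<in>I. c i * x i ^ (k + 2))\<^sup>2" for k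
      unfolding power2_eq_square sum_product
      unfolding sum_distrib_left
      by (intro sum.cong refl) (simp only: power_mult_distrib mult_ac)
    moreover have "0 \<le> ?a k * r ^ (k + 2) * (\<Sum>i\<in>I. c i * x i ^ (k + 2))\<^sup>2" for k
      using r by (intro mult_nonneg_nonneg) (auto simp: field_simps)
    ultimately show ?thesis
      by (metis (no_types, lifting) sums_le sums_zero)
  qed
  have "(?Q \<longlongrightarrow> (\<Sum>i\<in>I. \<Sum>j\<in>I. c i * c j * lnT (1 * (x i * x j)))) (at_left 1)"
  proof (intro tendsto_sum tendsto_mult_left)
    fix i j assume ij: "i \<in> I" "j \<in> I"
    have ev: "eventually (\<lambda>r. r \<in> {0<..<1}) (at_left (1::real))"
      by (intro eventually_at_left_real) auto
    have "eventually (\<lambda>r. r * (x i * x j) \<in> {..1}) (at_left 1)"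
      by (rule eventually_mono[OF ev]) (use xx[OF ij] in \<open>auto intro: mult_le_one\<close>)
    then show "((\<lambda>r. lnT (r * (x i * x j))) \<longlongrightarrow> lnT (1 * (x i * x j))) (at_left 1)"
      using xx[OF ij]
      by (intro continuous_on_tendsto_compose[OF continuous_on_lnT] tendsto_mult_right tendsto_ident_at) auto
  qed
  moreover have "eventually (\<lambda>r. 0 \<le> ?Q r) (at_left 1)"
    by (rule eventually_mono[OF eventually_at_left_real[of 0 1]]) (use pos in auto)
  ultimately show ?thesis
    by (intro tendsto_lowerbound[where F = "at_left (1::real)"]) auto
qed

lemma eta_mult: "0 \<le> x \<Longrightarrow> 0 \<le> y \<Longrightarrow> eta (x * y) = x * eta y + y * eta x"
  by (cases "x = 0 \<or> y = 0") (auto simp: eta_def ln_mult algebra_simps)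

text \<open>Each of the first three terms has a bare factor \<open>x\<close> or \<open>y\<close>, so
  only \<open>- lnT\<close> survives in the quadratic form when the weighted sum of the points is
  0.\<close>

lemma bent_mult: "0 \<le> x \<Longrightarrow> 0 \<le> y \<Longrightarrow> bent (x * y) = x * eta y + y * eta x + x * y - lnT (x * y)"
  by (simp add: bent_def eta_mult lnT_def)

text \<open>For a law \<open>p\<close> on the points \<open>x i\<close>,
  \<open>bform I x p p\<close> is the mean of \<open>bent (X * Y)\<close> with \<open>X\<close>,
  \<open>Y\<close> independent of law \<open>p\<close>.\<close>

definition bform :: "'i set \<Rightarrow> ('i \<Rightarrow> real) \<Rightarrow> ('i \<Rightarrow> real) \<Rightarrow> ('i \<Rightarrow> real) \<Rightarrow> real" where
  "bform I x v w = (\<Sum>i\<in>I. \<Sum>j\<in>I. v i * w j * bent (x i * x j))"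

lemma bform_nonpos:
  assumes "finite I" and x: "\<And>i. i \<in> I \<Longrightarrow> 0 \<le> x i \<and> x i \<le> 1"
    and 0: "(\<Sum>i\<in>I. c i * x i) = 0"
  shows "bform I x c c \<le> 0"
proof -
  have "bform I x c c = (\<Sum>i\<in>I. \<Sum>j\<in>I. (c i * x i) * (c j * eta (x j)) + (c i * eta (x i)) * (c j * x j)
      + (c i * x i) * (c j * x j) - c i * c j * lnT (x i * x j))"
    unfolding bform_def
    by (intro sum.cong refl) (simp add: bent_mult x algebra_simps)
  also have "\<dots> = - (\<Sum>i\<in>I. \<Sum>j\<in>I. c i * c j * lnT (x i * x j))"
    unfolding sum.distrib sum_subtractf sum_product[symmetric] 0 by simp
  finally show ?thesis
    using lnT_kernel_nonneg[OF assms(1,2)] by simp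
qed

lemma bform_sym: "bform I x v w = bform I x w v"
  unfolding bform_def by (subst sum.swap) (simp add: mult_ac)

text \<open>Concavity on weights of equal mean: \<open>bform_nonpos\<close> applied to
  \<open>v - w\<close>.\<close>

lemma bform_polarization:
  assumes "finite I" and x: "\<And>i. i \<in> I \<Longrightarrow> 0 \<le> x i \<and> x i \<le> 1"
    and "(\<Sum>i\<in>I. v i * x i) = (\<Sum>i\<in>I. w i * x i)"
  shows "bform I x v v + bform I x w w \<le> 2 * bform I x v w"
proof -
  have "bform I x (\<lambda>i. v i - w i) (\<lambda>i. v i - w i) =
      bform I x v v - bform I x v w - bform I x w v + bform I x w w"
    by (simp add: bform_def algebra_simps sum.distrib sum_subtractf)
  moreover have "bform I x (\<lambda>i. v i - w i) (\<lambda>i. v i - w i) \<le> 0"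
    using assms by (intro bform_nonpos) (auto simp: left_diff_distrib sum_subtractf)
  ultimately show ?thesis by (simp add: bform_sym[of I x w v])
qed

section \<open>Two-point laws and the mean inequality\<close>

lemma continuous_on_bent: "continuous_on {0..1} bent"
  unfolding bent_def
  by (intro continuous_intros continuous_on_compose2[OF continuous_on_eta]) auto

lemma eta_deriv: "0 < x \<Longrightarrow> (eta has_real_derivative - ln x - 1) (at x)"
  unfolding eta_def by (auto intro!: derivative_eq_intros)

lemma bent_deriv:
  assumes "0 < x" "x < 1"
  shows "(bent has_real_derivative (ln (1 - x) - ln x)) (at x)"
  unfolding bent_def
  using assms by (auto intro!: derivative_eq_intros DERIV_chain2[OF eta_deriv] eta_deriv)

lemma bent_scale_deriv:
  assumes "0 < a" "a \<le> 1" "0 < x" "x < 1"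
  shows "((\<lambda>x. bent (a * x)) has_real_derivative a * (ln (1 - a * x) - ln (a * x))) (at x)"
proof -
  have "a * x \<le> 1 * x" using assms by (intro mult_right_mono) auto
  then have "a * x < 1" using assms by linarith
  moreover have "0 < a * x" using assms by simp
  ultimately have "((\<lambda>x. bent (a * x)) has_real_derivative (ln (1 - a * x) - ln (a * x)) * a) (at x)"
    by (intro DERIV_chain2[where g = "\<lambda>x. a * x" and f = bent] bent_deriv)
      (auto intro!: derivative_eq_intros)
  then show ?thesis by (simp add: mult.commute)
qed

text \<open>The factor \<open>1 / (x * (1 - x))\<close> is common to all scales \<open>a\<close>, so
  only the fractions \<open>a * (1 - x) / (1 - a * x)\<close> matter for the sign of a combination;
  at \<open>a = 1\<close> the fraction is 1.\<close>

lemma bent_scale_deriv2: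
  assumes "0 < a" "a \<le> 1" "0 < x" "x < 1"
  shows "((\<lambda>x. a * (ln (1 - a * x) - ln (a * x))) has_real_derivative
    - (a * (1 - x) / (1 - a * x)) / (x * (1 - x))) (at x)"
proof -
  have "a * x \<le> 1 * x" using assms by (intro mult_right_mono) auto
  then have "a * x < 1" using assms by linarith
  moreover have "0 < a * x" using assms by simp
  ultimately show ?thesis
    using assms
    by (auto intro!: derivative_eq_intros simp: divide_simps)
qed

lemma scale_frac_antimono:
  assumes "0 \<le> a" "a \<le> 1" "x \<le> y" "y < (1::real)" "0 \<le> x"
  shows "a * (1 - y) / (1 - a * y) \<le> a * (1 - x) / (1 - a * x)"
    and "0 < a \<Longrightarrow> a < 1 \<Longrightarrow> x < y \<Longrightarrow> a * (1 - y) / (1 - a * y) < a * (1 - x) / (1 - a * x)"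
proof -
  have "a * y \<le> 1 * y" "a * x \<le> 1 * x" using assms by (intro mult_right_mono; auto)+
  then have 1: "1 - a * y > 0" "1 - a * x > 0" using assms by linarith+
  have e: "a * (1 - x) * (1 - a * y) - a * (1 - y) * (1 - a * x) = a * ((1 - a) * (y - x))"
    by (simp add: algebra_simps)
  have "0 \<le> a * ((1 - a) * (y - x))" using assms by simp
  then show "a * (1 - y) / (1 - a * y) \<le> a * (1 - x) / (1 - a * x)"
    using 1 e by (subst frac_le_eq) (auto simp: divide_le_0_iff)
  assume "0 < a" "a < 1" "x < y"
  then have "0 < a * ((1 - a) * (y - x))" by simp
  then show "a * (1 - y) / (1 - a * y) < a * (1 - x) / (1 - a * x)"
    using 1 e by (subst frac_less_eq) (auto simp: divide_less_0_iff)
qed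

text \<open>The mean of \<open>bent (X * Y)\<close> minus \<open>c\<close> times the mean of
  \<open>bent X\<close>, for the law with mass \<open>l\<close> at \<open>a\<close> and
  \<open>1 - l\<close> at \<open>b\<close>.\<close>

definition two_pt :: "real \<Rightarrow> real \<Rightarrow> real \<Rightarrow> real \<Rightarrow> real" where
  "two_pt c l a b = l\<^sup>2 * bent (a\<^sup>2) + 2 * l * (1 - l) * bent (a * b) + (1 - l)\<^sup>2 * bent (b\<^sup>2)
    - c * (l * bent a + (1 - l) * bent b)"

lemma two_pt_swap: "two_pt c (1 - l) b a = two_pt c l a b"
  by (simp add: two_pt_def mult_ac)

definition two_pt_set :: "real \<Rightarrow> (real \<times> real \<times> real) set" where
  "two_pt_set m = {(l, a, b). l \<in> {0..1} \<and> a \<in> {0..1} \<and> b \<in> {0..1} \<and> l * a + (1 - l) * b = m}"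

lemma compact_two_pt_set: "compact (two_pt_set m)"
proof -
  have "two_pt_set m = ({0..1} \<times> {0..1} \<times> {0..1}) \<inter> {p. fst p * fst (snd p) + (1 - fst p) * snd (snd p) = m}"
    by (auto simp: two_pt_set_def)
  moreover have "closed {p::real\<times>real\<times>real. fst p * fst (snd p) + (1 - fst p) * snd (snd p) = m}"
    by (intro closed_Collect_eq continuous_intros)
  ultimately show ?thesis
    by (simp add: compact_Int_closed compact_Times)
qed

lemma continuous_on_two_pt: "continuous_on (two_pt_set m) (\<lambda>(l, a, b). two_pt c l a b)"
  unfolding two_pt_def case_prod_unfold two_pt_set_def
  by (intro continuous_intros continuous_on_compose2[OF continuous_on_bent])
    (auto intro: mult_le_one simp: power_le_one)

text \<open>By concavity no mixture of the two laws is needed to bound the first variation \<open>g\<close>.\<close>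

lemma two_pt_first_order:
  assumes "(l, a, b) \<in> two_pt_set m" "(l', a', b') \<in> two_pt_set m" "two_pt c l a b \<le> two_pt c l' a' b'"
  defines "g \<equiv> \<lambda>x. 2 * (l * bent (a * x) + (1 - l) * bent (b * x)) - c * bent x"
  shows "l * g a + (1 - l) * g b \<le> l' * g a' + (1 - l') * g b'"
proof -
  \<comment> \<open>Both laws live on one list of four points, so that polarization can compare
    them.\<close>
  define x where "x i = (if i = 0 then a else if i = 1 then b else if i = 2 then a' else b')" for i :: nat
  define v where "v i = (if i = 0 then l else if i = 1 then 1 - l else 0)" for i :: nat
  define w where "w i = (if i = 2 then l' else if i = 3 then 1 - l' else 0)" for i :: nat
  have "bform {0,1,2,3} x v v + bform {0,1,2,3} x w w \<le> 2 * bform {0,1,2,3} x v w"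
    using assms(1,2) by (intro bform_polarization) (auto simp: x_def v_def w_def two_pt_set_def)
  then show ?thesis
    using assms(3)
    by (simp add: bform_def x_def v_def w_def g_def two_pt_def algebra_simps power2_eq_square)
qed

text \<open>Left of the mean, the first variation \<open>g\<close> stays above its chord through
  \<open>a\<close> and \<open>b\<close>, so it touches the chord at \<open>a\<close>. A concave
  \<open>g\<close> there would cross the chord at once; a convex one would lie below it between
  \<open>a\<close> and \<open>b\<close>.\<close>

lemma two_pt_interior_not_min:
  assumes c: "0 \<le> c" and "0 < l" "l < 1" "0 < a" "a < b" "b \<le> 1"
    and m: "m = l * a + (1 - l) * b"
    and min: "\<And>l' a' b'. (l', a', b') \<in> two_pt_set m \<Longrightarrow> two_pt c l a b \<le> two_pt c l' a' b'"
  shows False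
proof -
  define g where "g x = 2 * (l * bent (a * x) + (1 - l) * bent (b * x)) - c * bent x" for x
  define g' where "g' x = 2 * (l * (a * (ln (1 - a * x) - ln (a * x))) + (1 - l) * (b * (ln (1 - b * x) - ln (b * x))))
    - c * (1 * (ln (1 - 1 * x) - ln (1 * x)))" for x
  define D where "D x = c - 2 * (l * (a * (1 - x) / (1 - a * x)) + (1 - l) * (b * (1 - x) / (1 - b * x)))" for x
  have "m - a = (1 - l) * (b - a)" "b - m = l * (b - a)" unfolding m by (simp_all add: algebra_simps)
  then have am: "a < m" and mb: "m < b" using assms(2-6) by (smt (verit) mult_pos_pos)+
  have S: "(l, a, b) \<in> two_pt_set m" using assms by (simp add: two_pt_set_def)
  have dg: "(g has_real_derivative g' x) (at x)" if "0 < x" "x < 1" for x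
    using bent_scale_deriv[of a x] bent_scale_deriv[of b x] bent_scale_deriv[of 1 x] that assms(4-6)
    unfolding g_def g'_def
    by (intro DERIV_diff DERIV_cmult DERIV_add) auto
  have dg': "(g' has_real_derivative D x / (x * (1 - x))) (at x)" if "0 < x" "x < 1" for x
  proof -
    have "(g' has_real_derivative 
       2 * (l * (- (a * (1 - x) / (1 - a * x)) / (x * (1 - x))) + (1 - l) * (- (b * (1 - x) / (1 - b * x)) / (x * (1 - x))))
       - c * (- (1 * (1 - x) / (1 - 1 * x)) / (x * (1 - x)))) (at x)"
      unfolding g'_def using that assms(4-6)
      by (intro DERIV_diff DERIV_cmult DERIV_add bent_scale_deriv2) auto
    also have "2 * (l * (- (a * (1 - x) / (1 - a * x)) / (x * (1 - x))) + (1 - l) * (- (b * (1 - x) / (1 - b * x)) / (x * (1 - x))))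
       - c * (- (1 * (1 - x) / (1 - 1 * x)) / (x * (1 - x))) = D x / (x * (1 - x))"
      using that unfolding D_def by (simp add: diff_divide_distrib add_divide_distrib ring_distribs)
    finally show ?thesis .
  qed
  define s where "s = (g b - g a) / (b - a)"
  define k where "k x = g x - g a - s * (x - a)" for x
  have kab: "k a = 0" "k b = 0" using assms by (simp_all add: k_def s_def)
  have k_nonneg: "k x \<ge> 0" if x: "0 \<le> x" "x < m" for x
  proof -
    \<comment> \<open>Competitor: mass \<open>t\<close> at \<open>x\<close> and the rest at
      \<open>b\<close>, with \<open>t\<close> chosen to keep the mean \<open>m\<close>.\<close>
    define t where "t = (b - m) / (b - x)"
    have "t * (b - x) = b - m" using x mb by (simp add: t_def)
    then have t3: "t * x + (1 - t) * b = m" by (simp add: algebra_simps)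
    have t: "0 < t" "t \<le> 1"
      using x mb by (auto simp: t_def)
    have "(t, x, b) \<in> two_pt_set m"
      using x mb assms t t3 by (auto simp: two_pt_set_def)
    then have "l * g a + (1 - l) * g b \<le> t * g x + (1 - t) * g b"
      using two_pt_first_order[OF S _ min, of t x b] unfolding g_def by blast
    moreover have "l * g a + (1 - l) * g b = l * k a + (1 - l) * k b + g a + s * (m - a)"
      unfolding k_def m by (simp add: algebra_simps)
    moreover have "t * g x + (1 - t) * g b = t * k x + (1 - t) * k b + g a + s * (m - a)"
      unfolding k_def t3[symmetric] by (simp add: algebra_simps)
    ultimately have "0 \<le> t * k x" using kab by simp
    then show ?thesis using t by (simp add: zero_le_mult_iff)
  qed
  have dk: "(k has_real_derivative g' x - s) (at x)" if "0 < x" "x < 1" for x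
    unfolding k_def by (auto intro!: derivative_eq_intros dg that)
  have a1: "a < 1" using assms by simp
  have "g' a - s = 0"
  proof (rule DERIV_local_min[OF dk])
    show "0 < min a (m - a)" using assms am by simp
    show "\<forall>y. \<bar>a - y\<bar> < min a (m - a) \<longrightarrow> k a \<le> k y"
      using k_nonneg kab by auto
  qed (use assms in auto)
  show False
  proof (cases "D a < 0")
    case True
    then have "D a / (a * (1 - a)) < 0"
      using assms a1 by (simp add: divide_less_0_iff zero_less_mult_iff)
    then obtain d where d: "d > 0" "\<And>h. h > 0 \<Longrightarrow> h < d \<Longrightarrow> g' (a + h) < g' a"
      using DERIV_neg_dec_right[OF dg'[of a]] assms a1 by auto
    define h where "h = min (d / 2) ((m - a) / 2)"
    have h: "0 < h" "h < d" "a + h < m"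
      using d am by (auto simp: h_def min_def field_simps)
    have "\<exists>z. a < z \<and> z < a + h \<and> k (a + h) - k a = (a + h - a) * (g' z - s)"
      using h assms mb by (intro MVT2 dk) auto
    then obtain z where z: "a < z" "z < a + h" "k (a + h) = h * (g' z - s)"
      using kab by auto
    have "g' z < s"
      using d(2)[of "z - a"] z h \<open>g' a - s = 0\<close> by simp
    then have "k (a + h) < 0" using z h by (simp add: mult_pos_neg)
    then show False using k_nonneg[of "a + h"] h assms by simp
  next
    case False
    \<comment> \<open>Strictness comes from the scale \<open>a < 1\<close>; the scale
      \<open>b\<close> may be 1, where the fraction is constant.\<close>
    have Dpos: "D y > 0" if "a < y" "y < 1" for y
    proof -
      have "l * (a * (1 - y) / (1 - a * y)) < l * (a * (1 - a) / (1 - a * a))"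
        using assms a1 that scale_frac_antimono(2)[of a a y] by (intro mult_strict_left_mono) auto
      moreover have "(1 - l) * (b * (1 - y) / (1 - b * y)) \<le> (1 - l) * (b * (1 - a) / (1 - b * a))"
        using assms a1 that scale_frac_antimono(1)[of b a y] by (intro mult_left_mono) auto
      ultimately show ?thesis using False unfolding D_def by argo
    qed
    \<comment> \<open>\<open>k\<close> vanishes at \<open>a\<close> and \<open>b\<close> and is
      nonnegative at \<open>x\<close> between them, so its mean slopes on the two sides contradict a
      strictly increasing \<open>g'\<close>.\<close>
    define x where "x = (a + m) / 2"
    have x: "a < x" "x < m" using am by (auto simp: x_def)
    obtain z1 where z1: "a < z1" "z1 < x" "k x - k a = (x - a) * (g' z1 - s)"
      using MVT2[of a x k "\<lambda>z. g' z - s"] x mb assms dk by force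
    have "(x - a) * (g' z1 - s) \<ge> 0" using z1 k_nonneg[of x] x assms kab by auto
    then have 1: "g' z1 \<ge> s" using x by (simp add: zero_le_mult_iff)
    \<comment> \<open>\<open>b\<close> may be 1, where \<open>bent\<close> has no derivative, so
      continuity is needed up to \<open>b\<close>.\<close>
    have cont: "continuous_on {x..b} k"
      unfolding k_def g_def
      by (intro continuous_intros continuous_on_compose2[OF continuous_on_bent])
        (use assms x in \<open>auto intro: mult_le_one\<close>)
    have "\<exists>l z. x < z \<and> z < b \<and> DERIV k z :> l \<and> k b - k x = (b - x) * l"
      using x mb assms dk by (intro MVT cont) (auto simp: real_differentiable_def, meson less_trans less_le_trans)
    then obtain e z2 where z2: "x < z2" "z2 < b" "DERIV k z2 :> e" "k b - k x = (b - x) * e"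
      by blast
    have "e = g' z2 - s" using DERIV_unique[OF z2(3) dk] z2 x assms by auto
    moreover have "(b - x) * e \<le> 0" using z2(4) kab k_nonneg[of x] x assms by auto
    then have "e \<le> 0" using x mb by (simp add: mult_le_0_iff)
    ultimately have 2: "g' z2 \<le> s" by simp
    have "g' z1 < g' z2"
    proof (rule DERIV_pos_imp_increasing[of z1 z2 g'])
      show "z1 < z2" using z1 z2 by simp
      fix y assume y: "z1 \<le> y" "y \<le> z2"
      then have "0 < y" "y < 1" "a < y" using z1 z2 assms by auto
      then show "\<exists>d. (g' has_real_derivative d) (at y) \<and> 0 < d"
        using dg'[of y] Dpos[of y] by (intro exI[of _ "D y / (y * (1 - y))"]) simp
    qed
    then show False using 1 2 by simp
  qed
qed

text \<open>A minimiser exists by compactness, and \<open>two_pt_interior_not_min\<close> leaves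
  only point masses and laws with one point at 0; there \<open>bnd\<close> applies.\<close>

lemma two_pt_nonneg:
  assumes K: "0 \<le> K" and m: "0 \<le> m" "m \<le> 1"
    and bnd: "\<And>x. m \<le> x \<Longrightarrow> x \<le> 1 \<Longrightarrow> K * x * bent x \<le> bent (x\<^sup>2)"
    and mem: "(l0, a0, b0) \<in> two_pt_set m"
  shows "0 \<le> two_pt (K * m) l0 a0 b0"
proof -
  let ?c = "K * m"
  obtain q where q: "q \<in> two_pt_set m"
      "\<And>p. p \<in> two_pt_set m \<Longrightarrow> (\<lambda>(l, a, b). two_pt ?c l a b) q \<le> (\<lambda>(l, a, b). two_pt ?c l a b) p"
    using continuous_attains_inf[OF compact_two_pt_set _ continuous_on_two_pt, of m ?c] mem by blast
  obtain l1 a1 b1 where q1: "q = (l1, a1, b1)" by (cases q) auto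
  have "\<exists>l a b. (l, a, b) \<in> two_pt_set m \<and> a \<le> b \<and>
      (\<forall>l' a' b'. (l', a', b') \<in> two_pt_set m \<longrightarrow> two_pt ?c l a b \<le> two_pt ?c l' a' b')"
  proof (cases "a1 \<le> b1")
    case True
    then show ?thesis using q q1 by (intro exI[of _ l1] exI[of _ a1] exI[of _ b1]) auto
  next
    case False
    then show ?thesis using q q1
      by (intro exI[of _ "1 - l1"] exI[of _ b1] exI[of _ a1])
        (auto simp: two_pt_swap two_pt_set_def add.commute)
  qed
  then obtain l a b where mem': "(l, a, b) \<in> two_pt_set m" and "a \<le> b"
    and min: "\<And>l' a' b'. (l', a', b') \<in> two_pt_set m \<Longrightarrow> two_pt ?c l a b \<le> two_pt ?c l' a' b'"
    by blast
  have l: "0 \<le> l" "l \<le> 1" "0 \<le> a" "a \<le> 1" "0 \<le> b" "b \<le> 1" "l * a + (1 - l) * b = m"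
    using mem' by (auto simp: two_pt_set_def)
  have diag: "?c * bent m \<le> bent (m\<^sup>2)" using bnd[of m] m by simp
  consider "a = 0" | "l = 0" | "l = 1" | "a = b" | "0 < l" "l < 1" "0 < a" "a < b"
    using l \<open>a \<le> b\<close> by fastforce
  then have "0 \<le> two_pt ?c l a b"
  proof cases
    case 1
    \<comment> \<open>Only \<open>b\<close> contributes; since \<open>m = (1 - l) * b\<close>, the
      claim is \<open>bnd\<close> at \<open>b\<close> times \<open>(1 - l)\<^sup>2\<close>.\<close>
    then have mb: "m = (1 - l) * b" using l by simp
    have "m \<le> b" using mb l by (simp add: mult_left_le_one_le)
    then have "(1 - l)\<^sup>2 * (K * b * bent b) \<le> (1 - l)\<^sup>2 * bent (b\<^sup>2)"
      using bnd[of b] l by (intro mult_left_mono) auto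
    then show ?thesis using 1 by (simp add: two_pt_def mb power2_eq_square mult_ac)
  next
    case 2
    then show ?thesis using l diag by (simp add: two_pt_def)
  next
    case 3
    then show ?thesis using l diag by (simp add: two_pt_def)
  next
    case 4
    then have "a = m" "b = m" using l by (auto simp: algebra_simps)
    moreover have "two_pt ?c l m m = bent (m\<^sup>2) - ?c * bent m"
      by (simp add: two_pt_def power2_eq_square algebra_simps)
    ultimately show ?thesis using diag by simp
  next
    case 5
    then show ?thesis
      using two_pt_interior_not_min[of ?c l a b m] min l K m by (metis mult_nonneg_nonneg)
  qed
  then show ?thesis using min[OF mem] by simp
qed

text \<open>Any law of mean \<open>m\<close> is a mixture of two-point laws \<open>nu\<close> of
  mean \<open>m\<close>. The two-point bound and polarization against \<open>p\<close> leave the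
  cross term \<open>bform I x nu p\<close>, linear in \<open>nu\<close>, which averages to
  \<open>bform I x p p\<close>.\<close>

theorem bform_ge_mean:
  fixes p x :: "'i \<Rightarrow> real"
  assumes "finite I" and p: "\<And>i. i \<in> I \<Longrightarrow> 0 \<le> p i" "(\<Sum>i\<in>I. p i) = 1"
    and x: "\<And>i. i \<in> I \<Longrightarrow> 0 \<le> x i \<and> x i \<le> 1"
    and m: "(\<Sum>i\<in>I. p i * x i) = m"
    and K: "0 \<le> K" and bnd: "\<And>y. m \<le> y \<Longrightarrow> y \<le> 1 \<Longrightarrow> K * y * bent y \<le> bent (y\<^sup>2)"
  shows "K * m * (\<Sum>i\<in>I. p i * bent (x i)) \<le> bform I x p p"
proof -
  have m0: "0 \<le> m" unfolding m[symmetric] using p x by (intro sum_nonneg) auto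
  have "m \<le> (\<Sum>i\<in>I. p i * 1)" unfolding m[symmetric] using p x by (intro sum_mono mult_left_mono) auto
  then have m1: "m \<le> 1" using p by simp
  define N where "N = {i \<in> I. x i \<le> m}"
  define J where "J = {i \<in> I. m < x i}"
  have fin: "finite N" "finite J" and un: "I = N \<union> J" "N \<inter> J = {}"
    using \<open>finite I\<close> by (auto simp: N_def J_def)
  have split: "(\<Sum>i\<in>I. f i) = (\<Sum>i\<in>N. f i) + (\<Sum>i\<in>J. f i)" for f :: "'i \<Rightarrow> real"
    unfolding un using fin un by (intro sum.union_disjoint) auto
  \<comment> \<open>The mean excess over \<open>m\<close>, equal to the mean deficit below it; it is
    0 exactly when all mass sits at \<open>m\<close>.\<close>
  define D where "D = (\<Sum>j\<in>J. p j * (x j - m))"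
  have "(\<Sum>i\<in>I. p i * (x i - m)) = 0"
    using p m by (simp add: right_diff_distrib sum_subtractf flip: sum_distrib_right)
  then have DN: "D = (\<Sum>i\<in>N. p i * (m - x i))"
    unfolding split D_def by (simp add: right_diff_distrib sum_subtractf)
  have "D \<ge> 0" unfolding D_def using p by (intro sum_nonneg) (auto simp: J_def)
  show ?thesis
  proof (cases "D = 0")
    case True
    have "0 \<le> p i * (x i - m)" if "i \<in> J" for i
      using p that by (auto simp: J_def)
    from sum_nonneg_0[OF fin(2) this True[unfolded D_def]]
    have "p i * (x i - m) = 0" if "i \<in> J" for i using that by blast
    moreover have "0 \<le> p i * (m - x i)" if "i \<in> N" for i
      using p that by (auto simp: N_def)
    from sum_nonneg_0[OF fin(1) this True[unfolded DN]]
    have "p i * (m - x i) = 0" if "i \<in> N" for i using that by blast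
    ultimately have px: "p i = 0 \<or> x i = m" if "i \<in> I" for i
      using that un by auto
    have "(\<Sum>i\<in>I. p i * bent (x i)) = (\<Sum>i\<in>I. p i * bent m)"
      using px by (intro sum.cong) auto
    also have "\<dots> = bent m" using p by (simp flip: sum_distrib_right)
    finally have 1: "(\<Sum>i\<in>I. p i * bent (x i)) = bent m" .
    have "bform I x p p = (\<Sum>i\<in>I. \<Sum>j\<in>I. p i * p j * bent (m\<^sup>2))"
      unfolding bform_def power2_eq_square 
    proof (intro sum.cong refl)
      fix i j assume "i \<in> I" "j \<in> I"
      then show "p i * p j * bent (x i * x j) = p i * p j * bent (m * m)"
        using px[of i] px[of j] by auto
    qed
    also have "\<dots> = bent (m\<^sup>2)" using p by (simp flip: sum_distrib_right sum_product)
    finally show ?thesis using 1 bnd[of m] m1 by simp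
  next
    case False
    then have D: "D > 0" using \<open>D \<ge> 0\<close> by simp
    \<comment> \<open>\<open>nu i j\<close> puts mass \<open>L i j\<close> at \<open>x i\<close> and
      the rest at \<open>x j\<close>, with mean \<open>m\<close>; mixing these with weights
      \<open>\<pi> i j\<close> recovers \<open>p\<close>.\<close>
    define L where "L i j = (x j - m) / (x j - x i)" for i j
    define \<pi> where "\<pi> i j = p i * p j * (x j - x i) / D" for i j
    define nu where "nu i j k = (if k = i then L i j else 0) + (if k = j then 1 - L i j else 0)" for i j k
    have \<pi>_nonneg: "\<pi> i j \<ge> 0" if "i \<in> N" "j \<in> J" for i j
      using that D p by (auto simp: \<pi>_def N_def J_def)
    have nu_sum: "(\<Sum>k\<in>I. nu i j k * f k) = L i j * f i + (1 - L i j) * f j" if "i \<in> N" "j \<in> J" for i j f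
    proof -
      have "nu i j k * f k = (if k = i then L i j * f k else 0) + (if k = j then (1 - L i j) * f k else 0)" for k
        by (simp add: nu_def distrib_right)
      then show ?thesis
        using that \<open>finite I\<close> by (simp add: sum.distrib N_def J_def)
    qed
    have mix: "(\<Sum>i\<in>N. \<Sum>j\<in>J. \<pi> i j * (\<Sum>k\<in>I. nu i j k * f k)) = (\<Sum>k\<in>I. p k * f k)" for f
    proof -
      have "(\<Sum>i\<in>N. \<Sum>j\<in>J. \<pi> i j * (\<Sum>k\<in>I. nu i j k * f k)) =
          (\<Sum>i\<in>N. \<Sum>j\<in>J. (p i * f i) * (p j * (x j - m)) / D + (p i * (m - x i)) * (p j * f j) / D)"
      proof (intro sum.cong refl)
        fix i j assume ij: "i \<in> N" "j \<in> J"
        then have "x j - x i > 0" by (auto simp: N_def J_def)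
        then show "\<pi> i j * (\<Sum>k\<in>I. nu i j k * f k) =
            (p i * f i) * (p j * (x j - m)) / D + (p i * (m - x i)) * (p j * f j) / D"
          using D unfolding nu_sum[OF ij] \<pi>_def L_def
          by (simp add: divide_simps) (simp add: algebra_simps)
      qed
      also have "\<dots> = (\<Sum>i\<in>N. p i * f i) * D / D + D * (\<Sum>j\<in>J. p j * f j) / D"
        unfolding sum.distrib sum_divide_distrib[symmetric] sum_product[symmetric]
        unfolding D_def[symmetric] DN[symmetric] ..
      finally show ?thesis using D by (simp add: split)
    qed
    have \<pi>_sum: "(\<Sum>i\<in>N. \<Sum>j\<in>J. \<pi> i j) = 1"
      using mix[of "\<lambda>_. 1"] p nu_sum[of _ _ "\<lambda>_. 1"] by simp
    have two: "K * m * (\<Sum>k\<in>I. nu i j k * bent (x k)) + bform I x p p \<le>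
        2 * (\<Sum>k\<in>I. nu i j k * (\<Sum>h\<in>I. p h * bent (x k * x h)))" if ij: "i \<in> N" "j \<in> J" for i j
    proof -
      have "x j - x i > 0" using ij by (auto simp: N_def J_def)
      then have L: "L i j * x i + (1 - L i j) * x j = m" "0 \<le> L i j" "L i j \<le> 1"
        using ij by (auto simp: L_def divide_simps N_def J_def) (simp add: algebra_simps)
      then have "(L i j, x i, x j) \<in> two_pt_set m"
        using ij x by (auto simp: two_pt_set_def N_def J_def)
      then have "0 \<le> two_pt (K * m) (L i j) (x i) (x j)"
        using two_pt_nonneg[OF K m0 m1 bnd] by blast
      moreover have "bform I x (nu i j) w = (\<Sum>k\<in>I. nu i j k * (\<Sum>h\<in>I. w h * bent (x k * x h)))" for w
        by (simp add: bform_def sum_distrib_left mult_ac)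
      moreover have "(\<Sum>k\<in>I. nu i j k * (\<Sum>h\<in>I. nu i j h * bent (x k * x h))) =
          two_pt (K * m) (L i j) (x i) (x j) + K * m * (\<Sum>k\<in>I. nu i j k * bent (x k))"
        unfolding nu_sum[OF ij] two_pt_def by (simp add: algebra_simps power2_eq_square)
      moreover have "(\<Sum>k\<in>I. nu i j k * x k) = (\<Sum>k\<in>I. p k * x k)"
        using nu_sum[OF ij, of x] L(1) m by simp
      then have "bform I x (nu i j) (nu i j) + bform I x p p \<le> 2 * bform I x (nu i j) p"
        using \<open>finite I\<close> x by (intro bform_polarization)
      ultimately show ?thesis by simp
    qed
    have "K * m * (\<Sum>i\<in>I. p i * bent (x i)) + bform I x p p =
        (\<Sum>i\<in>N. \<Sum>j\<in>J. \<pi> i j * (K * m * (\<Sum>k\<in>I. nu i j k * bent (x k)) + bform I x p p))"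
      unfolding mix[symmetric] distrib_left sum.distrib
      by (simp add: sum_distrib_left \<pi>_sum mult_ac flip: sum_distrib_right)
    also have "\<dots> \<le> (\<Sum>i\<in>N. \<Sum>j\<in>J. \<pi> i j * (2 * (\<Sum>k\<in>I. nu i j k * (\<Sum>h\<in>I. p h * bent (x k * x h)))))"
      by (intro sum_mono mult_left_mono two \<pi>_nonneg)
    also have "\<dots> = 2 * (\<Sum>k\<in>I. p k * (\<Sum>h\<in>I. p h * bent (x k * x h)))"
      unfolding mix[symmetric] by (simp add: sum_distrib_left mult_ac)
    also have "\<dots> = 2 * bform I x p p"
      by (simp add: bform_def sum_distrib_left mult_ac)
    finally show ?thesis by simp
  qed
qed

section \<open>Entropy of random subsets and of unions\<close>

text \<open>Unnormalised entropy of cutting a mass \<open>a + b\<close> into \<open>a\<close> and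
  \<open>b\<close>: \<open>a + b\<close> times the binary entropy of the proportion.\<close>

definition split_ent :: "real \<Rightarrow> real \<Rightarrow> real" where
  "split_ent a b = eta a + eta b - eta (a + b)"

lemma split_ent_0 [simp]: "split_ent 0 b = 0" "split_ent a 0 = 0"
  by (simp_all add: split_ent_def)

lemma split_ent_scale:
  assumes "0 \<le> t" "0 \<le> a" "0 \<le> b"
  shows "split_ent (t * a) (t * b) = t * split_ent a b"
proof -
  have e: "t * a + t * b = t * (a + b)" by (simp add: algebra_simps)
  show ?thesis
    unfolding split_ent_def e using assms
    by (simp only: eta_mult add_nonneg_nonneg) (simp add: algebra_simps)
qed

lemma split_ent_bent:
  assumes "0 \<le> t" "0 \<le> x" "x \<le> 1"
  shows "split_ent (t * x) (t - t * x) = t * bent x"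
  using split_ent_scale[of t x "1 - x"] assms
  by (simp add: split_ent_def bent_def right_diff_distrib)

lemma eta_add_mult_ln_le:
  assumes "0 \<le> a" "0 < t"
  shows "eta a + a * ln t \<le> t - a"
proof (cases "a = 0")
  case False
  then have "a * ln (t / a) \<le> a * (t / a - 1)"
    using assms by (intro mult_left_mono ln_le_minus_one) auto
  then show ?thesis
    using False assms by (simp add: eta_def ln_div algebra_simps)
qed (use assms in simp)

text \<open>Gibbs' inequality: describing the cut by possibly wrong proportions \<open>s\<close>,
  \<open>1 - s\<close> costs at least its entropy.\<close>

lemma split_ent_le:
  assumes "0 \<le> a" "0 \<le> b" "0 < s" "s < 1"
  shows "split_ent a b \<le> - a * ln s - b * ln (1 - s)"
proof (cases "a + b = 0")
  case True
  then have "a = 0" using assms by linarith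
  then show ?thesis using True by simp
next
  case False
  then have pos: "0 < a + b" using assms by auto
  have "eta a + a * ln (s * (a + b)) \<le> s * (a + b) - a"
    using assms pos by (intro eta_add_mult_ln_le) auto
  moreover have "eta b + b * ln ((1 - s) * (a + b)) \<le> (1 - s) * (a + b) - b"
    using assms pos by (intro eta_add_mult_ln_le) auto
  moreover have "ln (s * (a + b)) = ln s + ln (a + b)" "ln ((1 - s) * (a + b)) = ln (1 - s) + ln (a + b)"
    using assms pos by (simp_all add: ln_mult)
  ultimately show ?thesis
    by (simp add: split_ent_def eta_def algebra_simps)
qed

text \<open>All summands are bounded with the proportion \<open>s\<close> of the totals; for the
  totals themselves that bound is an equality. In entropy terms, conditioning cannot raise
  entropy.\<close>

lemma split_ent_sum:
  assumes "finite I" and nn: "\<And>i. i \<in> I \<Longrightarrow> 0 \<le> f i" "\<And>i. i \<in> I \<Longrightarrow> 0 \<le> g i"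
  shows "(\<Sum>i\<in>I. split_ent (f i) (g i)) \<le> split_ent (\<Sum>i\<in>I. f i) (\<Sum>i\<in>I. g i)"
proof -
  define F where "F = (\<Sum>i\<in>I. f i)"
  define G where "G = (\<Sum>i\<in>I. g i)"
  have FG: "0 \<le> F" "0 \<le> G" unfolding F_def G_def using nn by (auto intro: sum_nonneg)
  consider "F = 0" | "G = 0" | "0 < F" "0 < G" using FG by linarith
  then show ?thesis
  proof cases
    case 1
    then have "\<And>i. i \<in> I \<Longrightarrow> f i = 0"
      using assms unfolding F_def by (simp add: sum_nonneg_eq_0_iff)
    then show ?thesis by simp
  next
    case 2
    then have "\<And>i. i \<in> I \<Longrightarrow> g i = 0"
      using assms unfolding G_def by (simp add: sum_nonneg_eq_0_iff)
    then show ?thesis by simp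
  next
    case 3
    define s where "s = F / (F + G)"
    have s: "0 < s" "s < 1" "1 - s = G / (F + G)" using 3 by (auto simp: s_def field_simps)
    have "(\<Sum>i\<in>I. split_ent (f i) (g i)) \<le> (\<Sum>i\<in>I. - f i * ln s - g i * ln (1 - s))"
      using nn s by (intro sum_mono split_ent_le) auto
    also have "\<dots> = - F * ln s - G * ln (1 - s)"
      by (simp add: F_def G_def sum_subtractf sum_negf flip: sum_distrib_right)
    also have "\<dots> = split_ent F G"
      using 3 unfolding s(3) unfolding s_def by (simp add: split_ent_def eta_def ln_div algebra_simps)
    finally show ?thesis unfolding F_def G_def .
  qed
qed

section \<open>Laws on subsets of a finite set and the law of a union\<close>

definition set_ent :: "'a set \<Rightarrow> ('a set \<Rightarrow> real) \<Rightarrow> real" where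
  "set_ent V p = (\<Sum>S\<in>Pow V. eta (p S))"

definition union_law :: "'a set \<Rightarrow> ('a set \<Rightarrow> real) \<Rightarrow> 'a set \<Rightarrow> real" where
  "union_law V p S = (\<Sum>A\<in>Pow V. \<Sum>B\<in>Pow V. if A \<union> B = S then p A * p B else 0)"

definition forget :: "'a \<Rightarrow> ('a set \<Rightarrow> real) \<Rightarrow> 'a set \<Rightarrow> real" where
  "forget v p S = p S + p (insert v S)"

lemma sum_Pow_insert:
  fixes f :: "'a set \<Rightarrow> real"
  assumes "finite V" "v \<notin> V"
  shows "(\<Sum>S\<in>Pow (insert v V). f S) = (\<Sum>S\<in>Pow V. f S + f (insert v S))"
proof -
  have inj: "inj_on (insert v) (Pow V)"
    using assms by (auto simp: inj_on_def)
  have "(\<Sum>S\<in>Pow (insert v V). f S) = (\<Sum>S\<in>Pow V. f S) + (\<Sum>S\<in>insert v ` Pow V. f S)"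
    unfolding Pow_insert using assms by (intro sum.union_disjoint) auto
  then show ?thesis
    by (simp add: sum.reindex[OF inj] sum.distrib)
qed

text \<open>Chain rule: forgetting \<open>v\<close> merges the masses of \<open>S\<close> and
  \<open>insert v S\<close>, and \<open>split_ent\<close> is the entropy lost.\<close>

lemma set_ent_insert:
  assumes "finite V" "v \<notin> V"
  shows "set_ent (insert v V) p = set_ent V (forget v p) + (\<Sum>S\<in>Pow V. split_ent (p S) (p (insert v S)))"
  using assms by (simp add: set_ent_def sum_Pow_insert split_ent_def forget_def flip: sum.distrib)

text \<open>\<open>v\<close> is missing from a union exactly when it is missing from both sets; the
  remaining mass of pairs is the mass with \<open>v\<close> present.\<close>

lemma union_law_insert:
  assumes "finite V" "v \<notin> V" "S \<in> Pow V"
  shows "union_law (insert v V) p S = (\<Sum>A\<in>Pow V. \<Sum>B\<in>Pow V. if A \<union> B = S then p A * p B else 0)"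
    and "union_law (insert v V) p (insert v S) =
      (\<Sum>A\<in>Pow V. \<Sum>B\<in>Pow V. if A \<union> B = S then forget v p A * forget v p B - p A * p B else 0)"
proof -
  have v: "v \<notin> S" "\<And>A. A \<in> Pow V \<Longrightarrow> v \<notin> A" using assms by auto
  show "union_law (insert v V) p S = (\<Sum>A\<in>Pow V. \<Sum>B\<in>Pow V. if A \<union> B = S then p A * p B else 0)"
    unfolding union_law_def sum_Pow_insert[OF assms(1,2)] sum.distrib[symmetric]
    using v(1) by (intro sum.cong refl) auto
  have eq: "insert v A = insert v B \<longleftrightarrow> A = B" "A \<noteq> insert v B" if "v \<notin> A" "v \<notin> B" for A B
    using that by auto
  show "union_law (insert v V) p (insert v S) =
      (\<Sum>A\<in>Pow V. \<Sum>B\<in>Pow V. if A \<union> B = S then forget v p A * forget v p B - p A * p B else 0)"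
    unfolding union_law_def sum_Pow_insert[OF assms(1,2)] sum.distrib[symmetric]
  proof (intro sum.cong refl)
    fix A B assume "A \<in> Pow V" "B \<in> Pow V"
    then have "v \<notin> A \<union> B" using v by auto
    then show "(if A \<union> B = insert v S then p A * p B else 0) +
        (if A \<union> insert v B = insert v S then p A * p (insert v B) else 0) +
        ((if insert v A \<union> B = insert v S then p (insert v A) * p B else 0) +
        (if insert v A \<union> insert v B = insert v S then p (insert v A) * p (insert v B) else 0)) =
        (if A \<union> B = S then forget v p A * forget v p B - p A * p B else 0)"
      using eq[of "A \<union> B" S] v(1) by (simp add: forget_def algebra_simps)
  qed
qed

lemma forget_union_law:
  assumes "finite V" "v \<notin> V" "S \<in> Pow V"
  shows "forget v (union_law (insert v V) p) S = union_law V (forget v p) S"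
  unfolding forget_def[of v "union_law _ _"] union_law_insert[OF assms]
  unfolding union_law_def sum.distrib[symmetric]
  by (intro sum.cong refl) auto

text \<open>Chain rule and data processing: given that the two sets restrict to \<open>A\<close> and \<open>B\<close> on \<open>V\<close>,
  the element \<open>v\<close> is missing from them independently, with probabilities \<open>p A / q A\<close> and
  \<open>p B / q B\<close>.\<close>

lemma set_ent_union_law_insert:
  assumes V: "finite V" "v \<notin> V" and p: "\<And>S. 0 \<le> p S"
  defines "q \<equiv> forget v p"
  shows "set_ent V (union_law V q) + bform (Pow V) (\<lambda>S. p S / q S) q q
    \<le> set_ent (insert v V) (union_law (insert v V) p)"
proof -
  let ?x = "\<lambda>S. p S / q S"
  have pq: "p S \<le> q S" "0 \<le> q S" for S using p by (simp_all add: q_def forget_def)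
  \<comment> \<open>If \<open>q S = 0\<close> the quotient is 0 by convention and
    \<open>p S = 0\<close> too, so \<open>q S * ?x S = p S\<close> holds in every case.\<close>
  have x: "0 \<le> ?x S" "?x S \<le> 1" "q S * ?x S = p S" for S
    using p[of S] pq[of S] by (auto simp: divide_simps)
  have pp: "p A * p B \<le> q A * q B" for A B
    using p pq by (intro mult_mono) auto
  have J: "split_ent (p A * p B) (q A * q B - p A * p B) = q A * q B * bent (?x A * ?x B)" for A B
  proof -
    have e: "q A * q B * (?x A * ?x B) = p A * p B" using x(3)[of A] x(3)[of B] by (metis mult.assoc mult.left_commute)
    have "0 \<le> ?x A * ?x B" "?x A * ?x B \<le> 1"
      using x(1,2)[of A] x(1,2)[of B] by (blast intro: mult_nonneg_nonneg mult_le_one)+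
    from split_ent_bent[OF mult_nonneg_nonneg[OF pq(2)[of A] pq(2)[of B]] this]
    show ?thesis unfolding e .
  qed
  have "bform (Pow V) ?x q q = (\<Sum>A\<in>Pow V. \<Sum>B\<in>Pow V. \<Sum>S\<in>Pow V. if A \<union> B = S then q A * q B * bent (?x A * ?x B) else 0)"
    unfolding bform_def using V by (intro sum.cong refl) (simp add: sum.delta')
  also have "\<dots> = (\<Sum>S\<in>Pow V. \<Sum>A\<in>Pow V. \<Sum>B\<in>Pow V. if A \<union> B = S then q A * q B * bent (?x A * ?x B) else 0)"
    by (subst (2) sum.swap) (subst sum.swap, rule refl)
  also have "\<dots> \<le> (\<Sum>S\<in>Pow V. split_ent (union_law (insert v V) p S) (union_law (insert v V) p (insert v S)))"
  proof (rule sum_mono)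
    fix S assume S: "S \<in> Pow V"
    let ?f = "\<lambda>A B. if A \<union> B = S then p A * p B else 0"
    let ?g = "\<lambda>A B. if A \<union> B = S then q A * q B - p A * p B else 0"
    have fg: "0 \<le> ?f A B" "0 \<le> ?g A B" for A B using p pp by auto
    have "(\<Sum>A\<in>Pow V. \<Sum>B\<in>Pow V. if A \<union> B = S then q A * q B * bent (?x A * ?x B) else 0) =
        (\<Sum>A\<in>Pow V. \<Sum>B\<in>Pow V. split_ent (?f A B) (?g A B))"
      by (intro sum.cong refl) (simp add: J)
    \<comment> \<open>Merging all pairs with the same union, first over \<open>B\<close> and then
      over \<open>A\<close>, can only raise the split entropy.\<close>
    also have "\<dots> \<le> (\<Sum>A\<in>Pow V. split_ent (\<Sum>B\<in>Pow V. ?f A B) (\<Sum>B\<in>Pow V. ?g A B))"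
      using V fg by (intro sum_mono split_ent_sum) auto
    also have "\<dots> \<le> split_ent (\<Sum>A\<in>Pow V. \<Sum>B\<in>Pow V. ?f A B) (\<Sum>A\<in>Pow V. \<Sum>B\<in>Pow V. ?g A B)"
      using V fg by (intro split_ent_sum sum_nonneg) auto
    finally show "(\<Sum>A\<in>Pow V. \<Sum>B\<in>Pow V. if A \<union> B = S then q A * q B * bent (?x A * ?x B) else 0)
        \<le> split_ent (union_law (insert v V) p S) (union_law (insert v V) p (insert v S))"
      unfolding union_law_insert[OF V S] q_def[symmetric] .
  qed
  finally have "bform (Pow V) ?x q q \<le> \<dots>" .
  moreover have "set_ent V (forget v (union_law (insert v V) p)) = set_ent V (union_law V q)"
    unfolding set_ent_def q_def using forget_union_law[OF V] by (intro sum.cong refl) auto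
  ultimately show ?thesis
    by (simp add: set_ent_insert[OF V])
qed

text \<open>Elements are added one at a time: the old part is the induction hypothesis, and the new
  conditional entropy is compared by \<open>bform_ge_mean\<close>.\<close>

theorem set_ent_union_law_ge:
  assumes "finite V" and p: "\<And>S. 0 \<le> p S" "(\<Sum>S\<in>Pow V. p S) = 1"
    and w: "\<And>v. v \<in> V \<Longrightarrow> w \<le> (\<Sum>S\<in>Pow V. if v \<notin> S then p S else 0)"
    and K: "0 \<le> K" and bnd: "\<And>y. w \<le> y \<Longrightarrow> y \<le> 1 \<Longrightarrow> K * y * bent y \<le> bent (y\<^sup>2)"
  shows "K * w * set_ent V p \<le> set_ent V (union_law V p)"
  using \<open>finite V\<close> p w
proof (induction V arbitrary: p rule: finite_induct)
  case empty
  then show ?case by (simp add: set_ent_def union_law_def)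
next
  case (insert v V)
  define q where "q = forget v p"
  define x where "x S = p S / q S" for S
  have pq: "p S \<le> q S" "0 \<le> q S" for S using insert.prems(1) by (simp_all add: q_def forget_def)
  have x: "0 \<le> x S" "x S \<le> 1" "q S * x S = p S" for S
    using insert.prems(1)[of S] pq[of S] by (auto simp: x_def divide_simps)
  have q1: "(\<Sum>S\<in>Pow V. q S) = 1"
    using insert.prems(2) unfolding sum_Pow_insert[OF insert.hyps(1,2)] by (simp add: q_def forget_def)
  have IH: "K * w * set_ent V q \<le> set_ent V (union_law V q)"
  proof (rule insert.IH[OF pq(2) q1])
    fix u assume u: "u \<in> V"
    then have "u \<noteq> v" using insert.hyps by auto
    have "w \<le> (\<Sum>S\<in>Pow (insert v V). if u \<notin> S then p S else 0)"
      using u by (intro insert.prems(3)) auto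
    also have "\<dots> = (\<Sum>S\<in>Pow V. if u \<notin> S then q S else 0)"
      unfolding sum_Pow_insert[OF insert.hyps(1,2)] using \<open>u \<noteq> v\<close>
      by (intro sum.cong refl) (auto simp: q_def forget_def)
    finally show "w \<le> (\<Sum>S\<in>Pow V. if u \<notin> S then q S else 0)" .
  qed
  \<comment> \<open>The probability that \<open>v\<close> is missing, written as the mean of the
    conditional probabilities \<open>x S\<close>.\<close>
  define m where "m = (\<Sum>S\<in>Pow V. q S * x S)"
  have "w \<le> (\<Sum>S\<in>Pow (insert v V). if v \<notin> S then p S else 0)"
    by (rule insert.prems(3)) simp
  also have "\<dots> = m"
    unfolding sum_Pow_insert[OF insert.hyps(1,2)] m_def x(3) using insert.hyps(2)
    by (intro sum.cong refl) auto
  finally have wm: "w \<le> m" .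
  have "K * m * (\<Sum>S\<in>Pow V. q S * bent (x S)) \<le> bform (Pow V) x q q"
    using insert.hyps pq q1 x wm K bnd by (intro bform_ge_mean) (auto simp: m_def)
  moreover have "K * w * (\<Sum>S\<in>Pow V. q S * bent (x S)) \<le> K * m * (\<Sum>S\<in>Pow V. q S * bent (x S))"
    using wm K pq x by (intro mult_right_mono mult_left_mono sum_nonneg mult_nonneg_nonneg bent_nonneg) auto
  moreover have "split_ent (p S) (p (insert v S)) = q S * bent (x S)" for S
    using split_ent_bent[of "q S" "x S"] x pq by (simp add: q_def forget_def)
  ultimately show ?case
    using set_ent_union_law_insert[OF insert.hyps(1,2), of p] insert.prems(1) IH
    by (simp add: set_ent_insert[OF insert.hyps(1,2)] distrib_left flip: q_def x_def)
qed

section \<open>Random variables\<close>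

lemma (in prob_space) prob_finite_range:
  assumes "finite T" "\<And>\<omega>. \<omega> \<in> space M \<Longrightarrow> Z \<omega> \<in> T"
    and "\<And>t. t \<in> T \<Longrightarrow> {\<omega> \<in> space M. Z \<omega> = t} \<in> events"
  shows "prob {\<omega> \<in> space M. P (Z \<omega>)} = (\<Sum>t\<in>T. if P t then prob {\<omega> \<in> space M. Z \<omega> = t} else 0)"
proof -
  have "{\<omega> \<in> space M. P (Z \<omega>)} = (\<Union>t\<in>{t \<in> T. P t}. {\<omega> \<in> space M. Z \<omega> = t})"
    using assms(2) by auto
  also have "prob \<dots> = (\<Sum>t\<in>{t \<in> T. P t}. prob {\<omega> \<in> space M. Z \<omega> = t})"
    using assms by (intro finite_measure_finite_Union) (auto simp: disjoint_family_on_def)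
  also have "\<dots> = (\<Sum>t\<in>T. if P t then prob {\<omega> \<in> space M. Z \<omega> = t} else 0)"
    using assms(1) by (simp add: sum.inter_filter)
  finally show ?thesis .
qed

lemma bent_sym: "bent (1 - x) = bent x"
  by (simp add: bent_def)

lemma binary_entropy_bent: "binary_entropy b p = bent p / ln b"
  by (simp add: binary_entropy_def bent_def eta_def log_def divide_inverse algebra_simps)

lemma (in information_space) entropy_set_ent:
  assumes "finite V" "X \<in> measurable M (count_space (Pow V))"
  shows "entropy b (count_space (Pow V)) X = set_ent V (\<lambda>S. prob {\<omega> \<in> space M. X \<omega> = S}) / ln b"
  using assms
  by (subst entropy_count_space_finite) (simp_all add: set_ent_def eta_def log_def sum_negf flip: sum_divide_distrib)

text \<open>Independence and equal laws give the pair the masses \<open>p S * p T\<close>, so the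
  union has law \<open>union_law\<close>; the base enters only through the common factor
  \<open>1 / ln b\<close>.\<close>

theorem (in information_space) entropy_Un_ge:
  assumes "finite V"
    and A: "A \<in> measurable M (count_space (Pow V))"
    and B: "B \<in> measurable M (count_space (Pow V))"
    and ind: "indep_var (count_space (Pow V)) A (count_space (Pow V)) B"
    and dist: "distr M (count_space (Pow V)) A = distr M (count_space (Pow V)) B"
    and w: "\<And>v. v \<in> V \<Longrightarrow> prob {\<omega> \<in> space M. v \<in> A \<omega>} \<le> 1 - w"
    and K: "0 \<le> K" and bnd: "\<And>y. w \<le> y \<Longrightarrow> y \<le> 1 \<Longrightarrow> K * y * bent y \<le> bent (y\<^sup>2)"
  shows "entropy b (count_space (Pow V)) A * (K * w)
    \<le> entropy b (count_space (Pow V)) (\<lambda>\<omega>. A \<omega> \<union> B \<omega>)"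
proof -
  define p where "p S = prob {\<omega> \<in> space M. A \<omega> = S}" for S
  have range: "A \<omega> \<in> Pow V" "B \<omega> \<in> Pow V" if "\<omega> \<in> space M" for \<omega>
    using measurable_space[OF A that] measurable_space[OF B that] by simp_all
  have ev: "{\<omega> \<in> space M. A \<omega> = S} \<in> events" "{\<omega> \<in> space M. B \<omega> = S} \<in> events" if "S \<in> Pow V" for S
    using measurable_sets[OF A, of "{S}"] measurable_sets[OF B, of "{S}"] that
    by (simp_all add: vimage_def Int_def conj_commute)
  have eqB: "prob {\<omega> \<in> space M. B \<omega> = S} = p S" if "S \<in> Pow V" for S
  proof -
    have "measure (distr M (count_space (Pow V)) A) {S} = measure (distr M (count_space (Pow V)) B) {S}"
      using dist by simp
    then show ?thesis
      using that A B by (simp add: measure_distr p_def vimage_def Int_def conj_commute)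
  qed
  have joint: "prob {\<omega> \<in> space M. (A \<omega>, B \<omega>) = (S, T)} = p S * p T" if "S \<in> Pow V" "T \<in> Pow V" for S T
  proof -
    have "prob ((\<lambda>\<omega>. (A \<omega>, B \<omega>)) -` ({S} \<times> {T}) \<inter> space M) =
        prob (A -` {S} \<inter> space M) * prob (B -` {T} \<inter> space M)"
      using that by (intro indep_varD[OF ind]) auto
    then show ?thesis
      using eqB[OF that(2)] by (simp add: p_def vimage_def Int_def conj_commute)
  qed
  have un: "(\<lambda>\<omega>. A \<omega> \<union> B \<omega>) \<in> measurable M (count_space (Pow V))"
  proof -
    have "(\<lambda>\<omega>. A \<omega> \<union> B \<omega>) -` {S} \<inter> space M =
        (\<Union>t\<in>{t \<in> Pow V \<times> Pow V. fst t \<union> snd t = S}. {\<omega> \<in> space M. A \<omega> = fst t} \<inter> {\<omega> \<in> space M. B \<omega> = snd t})" for S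
      using range by force
    moreover have "\<dots> S \<in> events" for S
      using \<open>finite V\<close> ev by (intro sets.finite_UN) auto
    ultimately show ?thesis
      using \<open>finite V\<close> range by (subst measurable_count_space_eq2) auto
  qed
  have law: "prob {\<omega> \<in> space M. A \<omega> \<union> B \<omega> = S} = union_law V p S" for S
  proof -
    have "prob {\<omega> \<in> space M. fst (A \<omega>, B \<omega>) \<union> snd (A \<omega>, B \<omega>) = S} =
        (\<Sum>t\<in>Pow V \<times> Pow V. if fst t \<union> snd t = S then prob {\<omega> \<in> space M. (A \<omega>, B \<omega>) = t} else 0)"
    proof (rule prob_finite_range)
      fix t assume "t \<in> Pow V \<times> Pow V"
      then have "{\<omega> \<in> space M. A \<omega> = fst t} \<inter> {\<omega> \<in> space M. B \<omega> = snd t} \<in> events"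
        using ev by (intro sets.Int) auto
      also have "{\<omega> \<in> space M. A \<omega> = fst t} \<inter> {\<omega> \<in> space M. B \<omega> = snd t} = {\<omega> \<in> space M. (A \<omega>, B \<omega>) = t}"
        by (auto simp: prod_eq_iff)
      finally show "{\<omega> \<in> space M. (A \<omega>, B \<omega>) = t} \<in> events" .
    qed (use \<open>finite V\<close> range in auto)
    also have "\<dots> = (\<Sum>t\<in>Pow V \<times> Pow V. if fst t \<union> snd t = S then p (fst t) * p (snd t) else 0)"
    proof (intro sum.cong refl)
      fix t assume "t \<in> Pow V \<times> Pow V"
      then have "prob {\<omega> \<in> space M. (A \<omega>, B \<omega>) = t} = p (fst t) * p (snd t)"
        using joint[of "fst t" "snd t"] by (simp add: mem_Times_iff)
      then show "(if fst t \<union> snd t = S then prob {\<omega> \<in> space M. (A \<omega>, B \<omega>) = t} else 0) =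
          (if fst t \<union> snd t = S then p (fst t) * p (snd t) else 0)"
        by simp
    qed
    finally show ?thesis
      by (simp add: union_law_def sum.cartesian_product case_prod_unfold)
  qed
  have total: "prob {\<omega> \<in> space M. P (A \<omega>)} = (\<Sum>S\<in>Pow V. if P S then p S else 0)" for P
    unfolding p_def using \<open>finite V\<close> range ev by (intro prob_finite_range) auto
  have "K * w * set_ent V p \<le> set_ent V (union_law V p)"
  proof (rule set_ent_union_law_ge[OF \<open>finite V\<close> _ _ _ K bnd])
    show "0 \<le> p S" for S by (simp add: p_def)
    show p1: "(\<Sum>S\<in>Pow V. p S) = 1"
      using total[of "\<lambda>_. True"] by (simp add: prob_space)
    fix v assume v: "v \<in> V"
    have "(\<Sum>S\<in>Pow V. p S) = (\<Sum>S\<in>Pow V. if v \<in> S then p S else 0) + (\<Sum>S\<in>Pow V. if v \<notin> S then p S else 0)"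
      unfolding sum.distrib[symmetric] by (intro sum.cong) auto
    then show "w \<le> (\<Sum>S\<in>Pow V. if v \<notin> S then p S else 0)"
      using w[OF v] unfolding total[of "\<lambda>S. v \<in> S"] p1 by linarith
  qed
  then have "K * w * set_ent V p / ln b \<le> set_ent V (union_law V p) / ln b"
    using b_gt_1 by (intro divide_right_mono) auto
  then show ?thesis
    using entropy_set_ent[OF \<open>finite V\<close> A] entropy_set_ent[OF \<open>finite V\<close> un]
    by (simp add: law mult_ac flip: p_def)
qed

theorem theorem2:
  fixes M :: "'a measure" and A B :: "'a \<Rightarrow> nat set"
    and n :: nat and b u :: real
  assumes "prob_space M"
    and "1 < b"
    and "0 < u" and "u \<le> 1"
    and "A \<in> measurable M (count_space (Pow {1..n}))"
    and "B \<in> measurable M (count_space (Pow {1..n}))"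
    and "prob_space.indep_var M (count_space (Pow {1..n})) A (count_space (Pow {1..n})) B"
    and "distr M (count_space (Pow {1..n})) A = distr M (count_space (Pow {1..n})) B"
    and "\<And>i. i \<in> {1..n} \<Longrightarrow> measure M {\<omega> \<in> space M. i \<in> A \<omega>} \<le> u"
  shows "(u \<le> (3 - sqrt 5) / 2 \<longrightarrow>
            prob_space.entropy M b (count_space (Pow {1..n})) (\<lambda>\<omega>. A \<omega> \<union> B \<omega>)
            \<ge> prob_space.entropy M b (count_space (Pow {1..n})) A
              * (binary_entropy b (2 * u - u\<^sup>2) / binary_entropy b u))
       \<and> (u \<ge> (3 - sqrt 5) / 2 \<longrightarrow>
            prob_space.entropy M b (count_space (Pow {1..n})) (\<lambda>\<omega>. A \<omega> \<union> B \<omega>)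
            \<ge> prob_space.entropy M b (count_space (Pow {1..n})) A
              * ((1 - u) * (2 / (sqrt 5 - 1))))"
proof -
  interpret information_space M b
    using assms(1,2) by (simp add: information_space_def information_space_axioms_def)
  define w where "w = 1 - u"
  have w: "0 \<le> w" "w < 1" using assms by (simp_all add: w_def)
  have main: "entropy b (count_space (Pow {1..n})) A * (K * w)
      \<le> entropy b (count_space (Pow {1..n})) (\<lambda>\<omega>. A \<omega> \<union> B \<omega>)"
    if "0 \<le> K" "\<And>y. w \<le> y \<Longrightarrow> y \<le> 1 \<Longrightarrow> K * y * bent y \<le> bent (y\<^sup>2)" for K
    using assms(9) that by (intro entropy_Un_ge assms(5-8)) (auto simp: w_def)
  \<comment> \<open>This is \<open>1 / golden\<close>, the least value of the ratio bounded in
    \<open>bent_sq_ge\<close>.\<close>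
  have "2 / (sqrt 5 - 1) = 1 + golden"
  proof -
    have "sqrt 5 - 1 > (0::real)" by simp
    then show ?thesis by (simp add: golden_def divide_simps) (simp add: algebra_simps)
  qed
  then have second: "entropy b (count_space (Pow {1..n})) A * ((1 - u) * (2 / (sqrt 5 - 1)))
      \<le> entropy b (count_space (Pow {1..n})) (\<lambda>\<omega>. A \<omega> \<union> B \<omega>)"
    using main[of "1 + golden"] bent_sq_ge golden_bounds w by (simp add: w_def mult.commute)
  have first: "entropy b (count_space (Pow {1..n})) A * (binary_entropy b (2 * u - u\<^sup>2) / binary_entropy b u)
      \<le> entropy b (count_space (Pow {1..n})) (\<lambda>\<omega>. A \<omega> \<union> B \<omega>)" if "u \<le> (3 - sqrt 5) / 2"
  proof -
    \<comment> \<open>The threshold \<open>(3 - sqrt 5) / 2\<close> equals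
      \<open>1 - golden\<close>.\<close>
    have gw: "golden \<le> w" using that by (simp add: golden_def w_def field_simps)
    then have w0: "0 < w" using golden_bounds by simp
    \<comment> \<open>The ratio at \<open>w\<close>, which is its least value on
      \<open>[w,1)\<close>; hence \<open>K\<close> is admissible and \<open>K * w\<close> is the
      quotient of entropies.\<close>
    define K where "K = bent (w\<^sup>2) / (w * bent w)"
    have "1 - (2 * u - u\<^sup>2) = w\<^sup>2" by (simp add: w_def power2_eq_square algebra_simps)
    then have "bent (2 * u - u\<^sup>2) = bent (w\<^sup>2)" by (metis bent_sym)
    moreover have "bent u = bent w" by (simp add: w_def bent_sym)
    ultimately have "binary_entropy b (2 * u - u\<^sup>2) / binary_entropy b u = K * w"
      using w0 b_gt_1 by (simp add: K_def binary_entropy_bent)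
    moreover have "0 \<le> K"
      unfolding K_def using w0 w by (intro divide_nonneg_nonneg mult_nonneg_nonneg bent_nonneg) (auto simp: power_le_one)
    ultimately show ?thesis
      using main[of K] bent_sq_ratio_mono[OF gw w(2)] by (simp add: K_def)
  qed
  show ?thesis using first second by blast
qed

end
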